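(* For every fixed integer $t\ge 2$, there exists a constant $D_t\ge 0$ such that the following holds. For any integer $r\ge 2$, there exist matchings $M_1,\dots,M_N$ of size $t$ in some $r$-partite $r$-uniform hypergraph with $tr$ vertices, where \[N\ge t^{r-D_t\sqrt{r}},\] such that whenever $e_1\in M_{j_1},\dots,e_t\in M_{j_t}$ are pairwise disjoint edges (for some indices $j_1,\dots,j_t\in \{1,\dots,N\}$), we must have $j_1=\dots=j_t$.
   Context: An $r$-uniform hypergraph is a hypergraph all of whose edges have exactly $r$ vertices; it is $r$-partite if its vertex set can be partitioned into $r$ parts such that every edge contains exactly one vertex from each part. A matching is a collection of pairwise disjoint edges; its size is the number of edges. *)

theory Defs
  imports Complex_Main "HOL-Library.Disjoint_Sets"
begin

definition hypergraph :: "'a set \<Rightarrow> 'a set set \<Rightarrow> bool" where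
  "hypergraph V E \<longleftrightarrow> finite V \<and> (\<forall>e\<in>E. e \<subseteq> V)"

definition uniform :: "nat \<Rightarrow> 'a set set \<Rightarrow> bool" where
  "uniform r E \<longleftrightarrow> (\<forall>e\<in>E. card e = r)"

text \<open>The parts are an indexed family, so that empty parts are permitted.\<close>

definition partite :: "nat \<Rightarrow> 'a set \<Rightarrow> 'a set set \<Rightarrow> bool" where
  "partite r V E \<longleftrightarrow>
     (\<exists>P :: nat \<Rightarrow> 'a set. disjoint_family_on P {1..r} \<and> (\<Union>i\<in>{1..r}. P i) = V \<and>
        (\<forall>e\<in>E. \<forall>i\<in>{1..r}. card (e \<inter> P i) = 1))"

definition matching :: "'a set set \<Rightarrow> 'a set set \<Rightarrow> bool" where
  "matching E M \<longleftrightarrow> M \<subseteq> E \<and> disjoint M"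

end

theory Submission
  imports Defs "HOL-Combinatorics.Permutations" "HOL-Number_Theory.Cong" "HOL-Library.FuncSet"
begin

text \<open>
  Edges are words of length \<open>r\<close> over an alphabet of size \<open>t\<close>, and a perfect matching is a tuple of
  \<open>t\<close> words whose columns are permutations. One coordinate is spent on labelling the \<open>i\<close>-th word of
  each matching by \<open>i\<close>. On the remaining \<open>R = r - 1\<close> coordinates, hash words by random weights and
  offsets in \<open>\<int>/M\<close>, and keep the tuples all of whose first \<open>t - 1\<close> hash values equal the same element
  of a Behrend-type set without nontrivial solutions of \<open>y\<^sub>1 + \<dots> + y\<^sub>n = n z\<close>, where \<open>n = t - 1\<close>.
  Every perfect matching uses all weights, so its hash values have a fixed sum; hence a perfect
  matching built from words of kept tuples is itself kept. It remains to delete the kept tuples that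
  share a word with another kept tuple. Counting pairs shows that at most half are lost in
  expectation once \<open>M\<close> is of order \<open>L ^ R\<close> with \<open>L ^ (n - 1) = n!\<close>. The loss of
  \<open>t\<close> to the power \<open>O(sqrt r)\<close> is the density of the Behrend-type set, with about \<open>sqrt r\<close> digits.
\<close>

section \<open>Sets without nontrivial means\<close>

lemma digits_unique:
  fixes a b :: "nat \<Rightarrow> nat"
  assumes "\<And>l. l < k \<Longrightarrow> a l < B" "\<And>l. l < k \<Longrightarrow> b l < B"
    and "(\<Sum>l<k. a l * B ^ l) = (\<Sum>l<k. b l * B ^ l)" "l < k"
  shows "a l = b l"
  using assms
proof (induction k arbitrary: a b l)
  case 0
  then show ?case by simp
next
  case (Suc k)
  have e: "(\<Sum>l<Suc k. f l * B ^ l) = f 0 + B * (\<Sum>l<k. f (Suc l) * B ^ l)" for f :: "nat \<Rightarrow> nat"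
    by (simp add: sum.lessThan_Suc_shift sum_distrib_left mult_ac del: sum.lessThan_Suc)
  have eq: "a 0 + B * (\<Sum>l<k. a (Suc l) * B ^ l) = b 0 + B * (\<Sum>l<k. b (Suc l) * B ^ l)"
    using Suc.prems(3) unfolding e .
  have a0: "a 0 < B" and b0: "b 0 < B" using Suc.prems by auto
  have "a 0 = b 0"
    using arg_cong[OF eq, of "\<lambda>x. x mod B"] a0 b0 by simp
  moreover have "(\<Sum>l<k. a (Suc l) * B ^ l) = (\<Sum>l<k. b (Suc l) * B ^ l)"
    using eq \<open>a 0 = b 0\<close> a0 by simp
  then have "a (Suc l) = b (Suc l)" if "l < k" for l
    using Suc.IH[of "\<lambda>l. a (Suc l)" "\<lambda>l. b (Suc l)" l] Suc.prems(1,2) that by simp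
  ultimately show ?case using Suc.prems(4) by (cases l) auto
qed

lemma digits_less:
  fixes a :: "nat \<Rightarrow> nat"
  assumes "\<And>l. l < k \<Longrightarrow> a l < B"
  shows "(\<Sum>l<k. a l * B ^ l) < B ^ k"
  using assms
proof (induction k)
  case 0
  then show ?case by simp
next
  case (Suc k)
  have "(\<Sum>l<k. a l * B ^ l) < B ^ k" using Suc by simp
  moreover have "(a k + 1) * B ^ k \<le> B * B ^ k"
    using Suc.prems[of k] by (intro mult_right_mono) auto
  ultimately show ?case by (simp add: algebra_simps)
qed

lemma pigeonhole_fibre:
  assumes "finite A" "finite V" "V \<noteq> {}" "f ` A \<subseteq> V"
  obtains v where "card A \<le> card V * card {a \<in> A. f a = v}"
proof (rule ccontr)
  assume "\<not> thesis"
  then have lt: "card V * card {a \<in> A. f a = v} < card A" for v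
    using that by (meson not_le)
  have "card A = (\<Sum>v\<in>V. card {a \<in> A. f a = v})"
    using sum.group[OF assms(1,2,4), of "\<lambda>_. 1::nat"] by simp
  then have "card V * card A = (\<Sum>v\<in>V. card V * card {a \<in> A. f a = v})"
    by (simp add: sum_distrib_left)
  also have "\<dots> < (\<Sum>v\<in>V. card A)"
    using assms lt by (intro sum_strict_mono) auto
  finally show False by simp
qed

text \<open>Expanding, and evaluating the cross term by the mean condition, gives sum of |a_i - b|^2
  = n v + n v - 2 n v = 0. So a point of a sphere is a mean of points of that sphere only
  trivially.\<close>

lemma equal_norm_mean:
  fixes a :: "nat \<Rightarrow> nat \<Rightarrow> nat" and b :: "nat \<Rightarrow> nat"
  assumes norm: "\<And>i. i < n \<Longrightarrow> (\<Sum>l<k. (a i l)\<^sup>2) = v" "(\<Sum>l<k. (b l)\<^sup>2) = v"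
    and mean: "\<And>l. l < k \<Longrightarrow> (\<Sum>i<n. a i l) = n * b l"
    and "i < n" "l < k"
  shows "a i l = b l"
proof -
  have "(\<Sum>i<n. \<Sum>l<k. (int (a i l) - int (b l))\<^sup>2) =
      (\<Sum>i<n. int (\<Sum>l<k. (a i l)\<^sup>2) + int (\<Sum>l<k. (b l)\<^sup>2)) - (\<Sum>i<n. \<Sum>l<k. 2 * (int (b l) * int (a i l)))"
    by (simp add: power2_diff sum.distrib sum_subtractf mult_ac)
  also have "(\<Sum>i<n. \<Sum>l<k. 2 * (int (b l) * int (a i l))) = (\<Sum>l<k. 2 * (int (b l) * int (\<Sum>i<n. a i l)))"
    by (subst sum.swap) (simp add: sum_distrib_left mult_ac)
  also have "\<dots> = (\<Sum>l<k. 2 * (int n * int ((b l)\<^sup>2)))"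
    by (intro sum.cong) (simp_all add: mean power2_eq_square mult_ac)
  also have "\<dots> = 2 * int n * int (\<Sum>l<k. (b l)\<^sup>2)"
    by (simp add: sum_distrib_left mult_ac)
  also have "(\<Sum>i<n. int (\<Sum>l<k. (a i l)\<^sup>2) + int (\<Sum>l<k. (b l)\<^sup>2)) = (\<Sum>i<n. 2 * int v)"
    using norm by (intro sum.cong) simp_all
  finally have z: "(\<Sum>i<n. \<Sum>l<k. (int (a i l) - int (b l))\<^sup>2) = 0"
    by (simp add: norm(2))
  have "(\<Sum>l<k. (int (a i l) - int (b l))\<^sup>2) = 0"
    using z \<open>i < n\<close> by (subst (asm) sum_nonneg_eq_0_iff) (auto intro: sum_nonneg)
  then have "(int (a i l) - int (b l))\<^sup>2 = 0"
    using \<open>l < k\<close> by (subst (asm) sum_nonneg_eq_0_iff) auto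
  then show ?thesis by simp
qed

text \<open>The equation is read modulo \<open>M\<close> because it is applied to hash values, which
  are only controlled modulo \<open>M\<close>.\<close>

definition mean_free :: "nat \<Rightarrow> nat \<Rightarrow> nat set \<Rightarrow> bool" where
  "mean_free n M S \<longleftrightarrow>
     (\<forall>y z. (\<forall>i<n. y i \<in> S) \<longrightarrow> z \<in> S \<longrightarrow> [(\<Sum>i<n. int (y i)) = int n * int z] (mod int M) \<longrightarrow>
        (\<forall>i<n. y i = z))"

text \<open>Behrend's construction: numbers whose \<open>k\<close> digits in base
  \<open>n * d\<close> are below \<open>d\<close> and form a vector of one fixed squared norm.
  Adding \<open>n\<close> of them produces no carry, so the mean equation holds digit by digit and
  \<open>equal_norm_mean\<close> applies. There are at most \<open>k * d\<^sup>2\<close> norms, so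
  pigeonhole keeps that fraction of the \<open>d ^ k\<close> digit vectors.\<close>

lemma behrend:
  fixes n d k :: nat
  assumes "n \<ge> 1" "d \<ge> 1" "k \<ge> 1"
  obtains S where "S \<subseteq> {..<(n * d) ^ k}" "mean_free n ((n * d) ^ k) S" "d ^ k \<le> k * d\<^sup>2 * card S"
proof -
  define B where "B = n * d"
  define A where "A = {..<k} \<rightarrow>\<^sub>E {..<d}"
  define nm where "nm a = (\<Sum>l<k. (a l)\<^sup>2)" for a :: "nat \<Rightarrow> nat"
  define val where "val a = (\<Sum>l<k. a l * B ^ l)" for a :: "nat \<Rightarrow> nat"
  have dB: "d \<le> B" using assms by (simp add: B_def)
  have A_less: "a l < d" if "a \<in> A" "l < k" for a l using that by (auto simp: A_def)
  have "nm a < k * d\<^sup>2" if "a \<in> A" for a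
  proof -
    have "nm a < (\<Sum>l<k. d\<^sup>2)"
      unfolding nm_def using A_less[OF that] assms
      by (intro sum_strict_mono) (auto simp: lessThan_empty_iff intro!: power_strict_mono)
    then show ?thesis by simp
  qed
  then have "nm ` A \<subseteq> {..<k * d\<^sup>2}" by auto
  moreover have "finite A" unfolding A_def by (intro finite_PiE) auto
  moreover have "{..<k * d\<^sup>2} \<noteq> {}" using assms by (simp add: lessThan_empty_iff)
  ultimately obtain v where v: "card A \<le> card {..<k * d\<^sup>2} * card {a \<in> A. nm a = v}"
    using pigeonhole_fibre[of A "{..<k * d\<^sup>2}" nm] by blast
  define A' where "A' = {a \<in> A. nm a = v}"
  have inj: "inj_on val A'"
  proof (rule inj_onI)
    fix a b assume ab: "a \<in> A'" "b \<in> A'" "val a = val b"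
    have "a l = b l" if "l < k" for l
    proof (rule digits_unique[of k a B b l])
      show "a l < B" if "l < k" for l using ab A_less[of a l] dB that by (auto simp: A'_def)
      show "b l < B" if "l < k" for l using ab A_less[of b l] dB that by (auto simp: A'_def)
    qed (use ab that in \<open>auto simp: val_def\<close>)
    then show "a = b"
      using ab unfolding A'_def A_def by (intro PiE_ext[of a "{..<k}" "\<lambda>_. {..<d}" b]) auto
  qed
  show ?thesis
  proof (rule that[of "val ` A'"])
    show "val ` A' \<subseteq> {..<(n * d) ^ k}"
    proof (rule image_subsetI)
      fix a assume "a \<in> A'"
      then have "a l < B" if "l < k" for l using A_less[of a l] that dB by (simp add: A'_def)
      then show "val a \<in> {..<(n * d) ^ k}"
        using digits_less[of k a B] by (simp add: val_def B_def)
    qed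
    show "d ^ k \<le> k * d\<^sup>2 * card (val ` A')"
      using v unfolding card_image[OF inj] A'_def[symmetric] by (simp add: A_def card_PiE)
    show "mean_free n ((n * d) ^ k) (val ` A')"
      unfolding mean_free_def B_def[symmetric]
    proof (intro allI impI)
      fix y z i
      assume y: "\<forall>i<n. y i \<in> val ` A'" and z: "z \<in> val ` A'" and "i < n"
        and cong: "[(\<Sum>i<n. int (y i)) = int n * int z] (mod int (B ^ k))"
      from y obtain a where a: "\<And>i. i < n \<Longrightarrow> a i \<in> A' \<and> y i = val (a i)"
        unfolding image_iff by metis
      from z obtain b where b: "b \<in> A'" "z = val b" by auto
      have ya: "(\<Sum>i<n. y i) = (\<Sum>l<k. (\<Sum>i<n. a i l) * B ^ l)"
        using a by (simp add: val_def sum_distrib_right sum.swap[of _ "{..<n}"])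
      have zb: "n * z = (\<Sum>l<k. (n * b l) * B ^ l)"
        by (simp add: b val_def sum_distrib_left mult_ac)
      have dig1: "(\<Sum>i<n. a i l) < B" if "l < k" for l
      proof -
        have "(\<Sum>i<n. a i l) < (\<Sum>i<n. d)"
          using a A_less that assms by (intro sum_strict_mono) (auto simp: A'_def lessThan_empty_iff)
        then show ?thesis by (simp add: B_def)
      qed
      have dig2: "n * b l < B" if "l < k" for l
        using b A_less that assms by (auto simp: A'_def B_def)
      \<comment> \<open>Neither side reaches the modulus \<open>B ^ k\<close>, so this congruence is
        an equality of integers.\<close>
      have "[(\<Sum>i<n. y i) = n * z] (mod (B ^ k))"
        using cong unfolding cong_int_iff[symmetric] by simp
      moreover have "(\<Sum>i<n. y i) < B ^ k" "n * z < B ^ k"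
        unfolding ya zb using dig1 dig2 by (auto intro!: digits_less)
      ultimately have "(\<Sum>i<n. y i) = n * z" by (simp add: cong_def)
      then have "(\<Sum>i<n. a i l) = n * b l" if "l < k" for l
        using digits_unique[of k "\<lambda>l. \<Sum>i<n. a i l" B "\<lambda>l. n * b l" l] that dig1 dig2
        unfolding ya zb by blast
      then have "a i l = b l" if "l < k" for l
        using equal_norm_mean[where n = n and k = k and a = a and b = b and v = v and i = i and l = l] that \<open>i < n\<close> a b by (auto simp: A'_def nm_def)
      then have "val (a i) = val b" by (simp add: val_def)
      then show "y i = z" using a b \<open>i < n\<close> by simp
    qed
  qed
qed

section \<open>Collisions of random hashes\<close>

text \<open>Extensional functions form a finite set, so expectations over random weights become
  plain counting.\<close>

definition weights :: "nat \<Rightarrow> nat \<Rightarrow> nat \<Rightarrow> (nat \<times> nat \<Rightarrow> int) set" where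
  "weights R t M = ({..<R} \<times> {..<t}) \<rightarrow>\<^sub>E {0..<int M}"

text \<open>\<open>X c i\<close> is the letter of word \<open>i\<close> at coordinate
  \<open>c\<close>. Storing a tuple by columns turns the perfect matching condition into a condition
  on each \<open>X c\<close> separately.\<close>

definition columns :: "nat \<Rightarrow> nat \<Rightarrow> (nat \<Rightarrow> nat \<Rightarrow> nat) set" where
  "columns R t = {..<R} \<rightarrow>\<^sub>E {p. p permutes {..<t}}"

definition hash :: "nat \<Rightarrow> (nat \<times> nat \<Rightarrow> int) \<Rightarrow> (nat \<Rightarrow> nat \<Rightarrow> nat) \<Rightarrow> nat \<Rightarrow> int" where
  "hash R w X i = (\<Sum>c<R. w (c, X c i))"

definition collisions ::
    "nat \<Rightarrow> nat \<Rightarrow> nat \<Rightarrow> (nat \<Rightarrow> nat \<Rightarrow> nat) \<Rightarrow> (nat \<Rightarrow> nat \<Rightarrow> nat) \<Rightarrow> (nat \<times> nat \<Rightarrow> int) set" where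
  "collisions R t M X Y =
     {w \<in> weights R t M. \<forall>i<t. [hash R w X i = hash R w Y i] (mod int M)}"

text \<open>Words of both tuples are numbered by the same indices, so these pairs form a graph on
  \<open>{..<t}\<close>. The more indices its components merge, the stronger the bound on the
  weights that make the tuples collide.\<close>

definition linked :: "nat \<Rightarrow> nat \<Rightarrow> (nat \<Rightarrow> nat \<Rightarrow> nat) \<Rightarrow> (nat \<Rightarrow> nat \<Rightarrow> nat) \<Rightarrow> (nat \<times> nat) set" where
  "linked R t X Y = {(i, j). i < t \<and> j < t \<and> (\<exists>c<R. X c i = Y c j)}"

lemma columnsD: "X \<in> columns R t \<Longrightarrow> c < R \<Longrightarrow> X c permutes {..<t}"
  by (auto simp: columns_def)

lemma columns_less: "X \<in> columns R t \<Longrightarrow> c < R \<Longrightarrow> i < t \<Longrightarrow> X c i < t"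
  using permutes_in_image[OF columnsD, of X R t c i] by simp

lemma columns_inject: "X \<in> columns R t \<Longrightarrow> c < R \<Longrightarrow> X c i = X c j \<longleftrightarrow> i = j"
  using permutes_inj[OF columnsD, of X R t c] by (auto dest: injD)

lemma columns_ext:
  assumes "X \<in> columns R t" "Y \<in> columns R t" "\<And>c i. c < R \<Longrightarrow> i < t \<Longrightarrow> X c i = Y c i"
  shows "X = Y"
proof (rule PiE_ext[of X "{..<R}" "\<lambda>_. {p. p permutes {..<t}}"])
  fix c assume c: "c \<in> {..<R}"
  show "X c = Y c"
  proof
    fix i
    show "X c i = Y c i"
      using assms(3)[of c i] permutes_not_in[OF columnsD[OF assms(1)], of c i]
        permutes_not_in[OF columnsD[OF assms(2)], of c i] c
      by (cases "i < t") auto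
  qed
qed (use assms in \<open>auto simp: columns_def\<close>)

lemma finite_columns [simp]: "finite (columns R t)"
  unfolding columns_def by (intro finite_PiE) (auto simp: finite_permutations)

lemma card_columns: "card (columns R t) = fact t ^ R"
  by (simp add: columns_def card_PiE card_permutations[OF refl])

lemma finite_weights [simp]: "finite (weights R t M)"
  unfolding weights_def by (intro finite_PiE) auto

lemma card_weights: "card (weights R t M) = M ^ (R * t)"
  by (simp add: weights_def card_PiE)

lemma hash_cong_mod:
  assumes "X \<in> columns R t" "i < t" "\<And>c v. c < R \<Longrightarrow> v < t \<Longrightarrow> [w (c, v) = w' (c, v)] (mod m)"
  shows "[hash R w X i = hash R w' X i] (mod m)"
  unfolding hash_def using columns_less[OF assms(1)] assms(2,3) by (intro cong_sum) auto

lemma hash_add: "hash R (\<lambda>p. w p + w' p) X i = hash R w X i + hash R w' X i"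
  by (simp add: hash_def sum.distrib)

text \<open>
  A unit weight on a position shared by word \<open>i\<close> of \<open>X\<close> and word \<open>j\<close> of \<open>Y\<close> moves the vector of hash
  differences by \<open>e\<^sub>i - e\<^sub>j\<close>. The image of the difference map therefore contains \<open>e\<^sub>i - e\<^sub>j\<close> for all linked
  \<open>i, j\<close>, which bounds its kernel from above over any modulus, prime or not.
\<close>

lemma linked_path_weight:
  assumes X: "X \<in> columns R t" and Y: "Y \<in> columns R t"
    and "(i, j) \<in> (linked R t X Y \<union> (linked R t X Y)\<inverse>)\<^sup>*"
  shows "\<exists>w. \<forall>k<t. hash R w X k - hash R w Y k = of_bool (k = i) - of_bool (k = j)"
  using assms(3)
proof (induction rule: rtrancl_induct)
  case base
  show ?case by (intro exI[of _ "\<lambda>_. 0"]) (simp add: hash_def)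
next
  have *: "\<exists>w. \<forall>k<t. hash R w X k - hash R w Y k = of_bool (k = a) - of_bool (k = b)"
    if "(a, b) \<in> linked R t X Y" for a b
  proof -
    from that obtain c where c: "c < R" "X c a = Y c b" by (auto simp: linked_def)
    have "hash R (\<lambda>p. of_bool (p = (c, X c a))) Z k = of_bool (Z c k = X c a)" for Z k
      unfolding hash_def using c(1) by (subst sum.remove[of _ c]) (auto intro!: sum.neutral)
    then show ?thesis
      by (intro exI[of _ "\<lambda>p. of_bool (p = (c, X c a))"])
        (simp add: c columns_inject[OF X c(1)] columns_inject[OF Y c(1)] flip: c(2),
         simp add: c(2) columns_inject[OF Y c(1)])
  qed
  have neg: "\<exists>w. \<forall>k<t. hash R w X k - hash R w Y k = of_bool (k = b) - of_bool (k = a)"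
    if "\<exists>w. \<forall>k<t. hash R w X k - hash R w Y k = of_bool (k = a) - of_bool (k = b)" for a b
  proof -
    from that obtain w where "\<forall>k<t. hash R w X k - hash R w Y k = of_bool (k = a) - of_bool (k = b)"
      by blast
    moreover have "hash R (\<lambda>p. - w p) Z k = - hash R w Z k" for Z k
      by (simp add: hash_def sum_negf)
    ultimately show ?thesis by (intro exI[of _ "\<lambda>p. - w p"]) force
  qed
  case (step j l)
  then obtain w where w: "\<forall>k<t. hash R w X k - hash R w Y k = of_bool (k = i) - of_bool (k = j)"
    by blast
  obtain w' where w': "\<forall>k<t. hash R w' X k - hash R w' Y k = of_bool (k = j) - of_bool (k = l)"
    using step.hyps(2) *[of j l] neg[OF *[of l j]] by blast
  show ?case
  proof (intro exI[of _ "\<lambda>p. w p + w' p"] allI impI)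
    fix k assume "k < t"
    then show "hash R (\<lambda>p. w p + w' p) X k - hash R (\<lambda>p. w p + w' p) Y k = of_bool (k = i) - of_bool (k = l)"
      using w[rule_format, of k] w'[rule_format, of k] unfolding hash_add by linarith
  qed
qed

text \<open>Each \<open>i\<close> with \<open>\<rho> i \<noteq> i\<close> gives a free direction:
  adding \<open>h a\<close> to a colliding weight shifts the hash difference at
  \<open>k \<in> I\<close> by exactly \<open>a k\<close>. Hence \<open>a\<close>, and then the
  weight, can be read off from the sum modulo \<open>M\<close>, and collisions paired with
  coefficient vectors inject into all weights.\<close>

lemma card_collisions:
  assumes X: "X \<in> columns R t" and Y: "Y \<in> columns R t" and M: "M > 0"
    and \<rho>: "\<And>i. i < t \<Longrightarrow> (i, \<rho> i) \<in> (linked R t X Y \<union> (linked R t X Y)\<inverse>)\<^sup>*"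
    and idem: "\<And>i. i < t \<Longrightarrow> \<rho> (\<rho> i) = \<rho> i"
  shows "card (collisions R t M X Y) * M ^ card {i. i < t \<and> \<rho> i \<noteq> i} \<le> M ^ (R * t)"
proof -
  define I where "I = {i. i < t \<and> \<rho> i \<noteq> i}"
  have [simp]: "finite I" by (simp add: I_def)
  define A where "A = I \<rightarrow>\<^sub>E {0..<int M}"
  obtain g where g: "\<And>i k. i < t \<Longrightarrow> k < t \<Longrightarrow>
      hash R (g i) X k - hash R (g i) Y k = of_bool (k = i) - of_bool (k = \<rho> i)"
    using linked_path_weight[OF X Y \<rho>] by metis
  define h where "h a p = (\<Sum>i\<in>I. a i * g i p)" for a p
  have hash_h: "hash R (h a) Z k = (\<Sum>i\<in>I. a i * hash R (g i) Z k)" for a Z k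
    unfolding hash_def h_def by (subst sum.swap) (simp add: sum_distrib_left)
  have diff_h: "hash R (h a) X k - hash R (h a) Y k = a k" if "k \<in> I" for a k
  proof -
    have "hash R (h a) X k - hash R (h a) Y k = (\<Sum>i\<in>I. a i * (hash R (g i) X k - hash R (g i) Y k))"
      by (simp add: hash_h sum_subtractf right_diff_distrib)
    \<comment> \<open>Representatives lie outside \<open>I\<close> by idempotence, so
      \<open>k = \<rho> i\<close> is impossible for \<open>k \<in> I\<close>.\<close>
    also have "\<dots> = (\<Sum>i\<in>I. a i * of_bool (k = i))"
      using that g idem by (intro sum.cong) (auto simp: I_def)
    also have "\<dots> = a k" using that by (simp add: sum.remove[of I k])
    finally show ?thesis .
  qed
  define \<Phi> where "\<Phi> = (\<lambda>(w, a). restrict (\<lambda>p. (w p + h a p) mod int M) ({..<R} \<times> {..<t}))"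
  have "inj_on \<Phi> (collisions R t M X Y \<times> A)"
  proof (rule inj_onI, clarify)
    fix w a w' a'
    assume w: "w \<in> collisions R t M X Y" and w': "w' \<in> collisions R t M X Y"
      and a: "a \<in> A" and a': "a' \<in> A" and eq: "\<Phi> (w, a) = \<Phi> (w', a')"
    have c: "[w (c, v) + h a (c, v) = w' (c, v) + h a' (c, v)] (mod int M)" if "c < R" "v < t" for c v
      using fun_cong[OF eq, of "(c, v)"] that by (simp add: \<Phi>_def cong_def)
    have "a k = a' k" if k: "k \<in> I" for k
    proof -
      have kt: "k < t" using k by (simp add: I_def)
      have D: "[hash R (\<lambda>p. v p + h b p) X k - hash R (\<lambda>p. v p + h b p) Y k = b k] (mod int M)"
        if "v \<in> collisions R t M X Y" for v b
      proof -
        have "[hash R v X k - hash R v Y k = 0] (mod int M)"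
          using that kt by (auto simp: collisions_def cong_diff_iff_cong_0)
        then have "[(hash R v X k - hash R v Y k) + b k = 0 + b k] (mod int M)"
          by (intro cong_add cong_refl)
        then show ?thesis using diff_h[OF k, of b] by (simp add: hash_add algebra_simps)
      qed
      have "[hash R (\<lambda>p. w p + h a p) X k - hash R (\<lambda>p. w p + h a p) Y k =
             hash R (\<lambda>p. w' p + h a' p) X k - hash R (\<lambda>p. w' p + h a' p) Y k] (mod int M)"
        using c kt by (intro cong_diff hash_cong_mod[OF X] hash_cong_mod[OF Y]) auto
      then have "[a k = a' k] (mod int M)"
        using D[OF w] D[OF w'] by (meson cong_sym cong_trans)
      moreover have "a k \<in> {0..<int M}" "a' k \<in> {0..<int M}" using a a' k by (auto simp: A_def)
      ultimately show ?thesis by (simp add: cong_def)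
    qed
    then have aa: "a = a'" using a a' unfolding A_def by (intro PiE_ext[of a I _ a']) auto
    have "w p = w' p" if p: "p \<in> {..<R} \<times> {..<t}" for p
    proof -
      have "[w p = w' p] (mod int M)" using c[of "fst p" "snd p"] p aa by (auto simp: cong_add_rcancel)
      moreover have "w p \<in> {0..<int M}" "w' p \<in> {0..<int M}"
        using w w' p by (auto simp: collisions_def weights_def)
      ultimately show ?thesis by (simp add: cong_def)
    qed
    moreover have "w \<in> weights R t M" "w' \<in> weights R t M"
      using w w' by (auto simp: collisions_def)
    ultimately have "w = w'" unfolding weights_def by (blast intro: PiE_ext)
    with aa show "w = w' \<and> a = a'" by simp
  qed
  moreover have "\<Phi> ` (collisions R t M X Y \<times> A) \<subseteq> weights R t M"
    using M by (auto simp: \<Phi>_def weights_def split: if_splits)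
  ultimately have "card (collisions R t M X Y \<times> A) \<le> card (weights R t M)"
    by (intro card_inj_on_le) auto
  then show ?thesis by (simp add: card_cartesian_product card_weights A_def card_PiE I_def)
qed

section \<open>Counting rival tuples\<close>

text \<open>For b at least 2 this is monotonicity of the (b-1)-th root of \<open>fact b\<close>,
  with the roots cleared. In the induction step \<open>fact b\<close> is a product of the
  \<open>b - 1\<close> factors 2, ..., b, none above \<open>n + 1\<close>.\<close>

lemma fact_power_le_fact_power:
  fixes b n :: nat
  assumes "1 \<le> b" "b \<le> n"
  shows "(fact b :: nat) ^ (n - 1) \<le> fact n ^ (b - 1)"
  using assms(2)
proof (induction n rule: dec_induct)
  case base
  show ?case by simp
next
  case (step n)
  have "(fact b :: nat) \<le> (n + 1) ^ (b - 1)"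
  proof -
    have "{1..b} = insert 1 {2..b}" using assms(1) by auto
    then have "(fact b :: nat) = (\<Prod>i\<in>{2..b}. i)"
      by (simp add: fact_prod)
    also have "\<dots> \<le> (\<Prod>i\<in>{2..b}. n + 1)" using step by (intro prod_mono) auto
    finally show ?thesis by simp
  qed
  moreover have "(fact b :: nat) ^ n = fact b ^ (n - 1) * fact b"
    using step assms(1) by (cases n) auto
  ultimately have "(fact b :: nat) ^ n \<le> fact n ^ (b - 1) * (n + 1) ^ (b - 1)"
    using step.IH by (simp add: mult_mono)
  also have "\<dots> = fact (Suc n) ^ (b - 1)" by (simp only: power_mult_distrib[symmetric] fact_Suc) (simp add: mult.commute)
  finally show ?case by simp
qed

text \<open>The case split avoids \<open>root 0\<close>, which is 0 by convention.\<close>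

definition rate :: "nat \<Rightarrow> real" where
  "rate n = (if n \<le> 1 then 1 else root (n - 1) (fact n))"

lemma rate_ge_1: "rate n \<ge> 1"
  by (simp add: rate_def)

lemma rate_power: "n \<ge> 1 \<Longrightarrow> rate n ^ (n - 1) = fact n"
  by (auto simp: rate_def le_Suc_eq)

text \<open>Permuting a class of size \<open>b\<close> costs one factor \<open>rate n\<close> for
  each of its \<open>b - 1\<close> non-representatives; each of these saves a factor
  \<open>M\<close> in \<open>card_collisions\<close>.\<close>

lemma fact_le_rate_power:
  assumes "1 \<le> b" "b \<le> n"
  shows "fact b \<le> rate n ^ (b - 1)"
proof (cases "n \<le> 1")
  case True
  with assms have "b = 1" by simp
  then show ?thesis by simp
next
  case False
  have "real (fact b ^ (n - 1)) \<le> real (fact n ^ (b - 1))"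
    using fact_power_le_fact_power[OF assms] by (intro of_nat_mono)
  then have "(fact b :: real) ^ (n - 1) \<le> (rate n ^ (n - 1)) ^ (b - 1)"
    using rate_power[of n] False by simp
  also have "(rate n ^ (n - 1)) ^ (b - 1) = (rate n ^ (b - 1)) ^ (n - 1)"
    by (simp add: mult.commute flip: power_mult)
  also have "n - 1 = Suc (n - 2)" using False by simp
  finally have "(fact b :: real) ^ Suc (n - 2) \<le> (rate n ^ (b - 1)) ^ Suc (n - 2)" .
  then show ?thesis
    by (rule power_le_imp_le_base) (use rate_ge_1[of n] in simp)
qed

text \<open>Such a permutation is determined by the permutations it induces on the fibres, which
  \<open>\<Psi>\<close> collects.\<close>

lemma card_fibre_preserving_permutations:
  fixes \<rho> :: "nat \<Rightarrow> nat"
  shows "card {p. p permutes {..<t} \<and> (\<forall>i<t. \<rho> (p i) = \<rho> i)} \<le>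
    (\<Prod>v\<in>\<rho> ` {..<t}. fact (card {i. i < t \<and> \<rho> i = v}))"
proof -
  define F where "F v = {i. i < t \<and> \<rho> i = v}" for v
  define P where "P = {p. p permutes {..<t} \<and> (\<forall>i<t. \<rho> (p i) = \<rho> i)}"
  define \<Psi> where "\<Psi> p = (\<lambda>v\<in>\<rho> ` {..<t}. \<lambda>i. if i \<in> F v then p i else i)" for p :: "nat \<Rightarrow> nat"
  have fin: "finite (F v)" for v by (simp add: F_def)
  have "inj_on \<Psi> P"
  proof (rule inj_onI, rule ext)
    fix p q i assume pq: "p \<in> P" "q \<in> P" and eq: "\<Psi> p = \<Psi> q"
    show "p i = q i"
    proof (cases "i < t")
      case True
      then show ?thesis
        using fun_cong[OF fun_cong[OF eq, of "\<rho> i"], of i] by (simp add: \<Psi>_def F_def)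
    next
      case False
      then show ?thesis using pq by (simp add: P_def permutes_not_in[of _ "{..<t}"])
    qed
  qed
  moreover have "\<Psi> p \<in> (\<Pi>\<^sub>E v\<in>\<rho> ` {..<t}. {q. q permutes F v})" if p: "p \<in> P" for p
  proof -
    have "(\<lambda>i. if i \<in> F v then p i else i) permutes F v" for v
    proof (rule bij_imp_permutes)
      have "inj_on p (F v)" using p by (auto simp: P_def intro: permutes_inj_on)
      moreover have "p ` F v \<subseteq> F v"
        using p permutes_in_image[of p "{..<t}"] by (auto simp: P_def F_def)
      ultimately have "bij_betw p (F v) (F v)"
        using fin by (simp add: bij_betw_def endo_inj_surj)
      then show "bij_betw (\<lambda>i. if i \<in> F v then p i else i) (F v) (F v)"
        by (simp cong: bij_betw_cong)
    qed auto
    then show ?thesis by (simp add: \<Psi>_def restrict_PiE_iff)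
  qed
  moreover have "finite (\<Pi>\<^sub>E v\<in>\<rho> ` {..<t}. {q. q permutes F v})"
    by (intro finite_PiE) (auto simp: fin finite_permutations)
  ultimately have "card P \<le> card (\<Pi>\<^sub>E v\<in>\<rho> ` {..<t}. {q. q permutes F v})"
    by (intro card_inj_on_le) auto
  also have "\<dots> = (\<Prod>v\<in>\<rho> ` {..<t}. fact (card (F v)))"
    by (simp add: card_PiE card_permutations[OF refl fin])
  finally show ?thesis by (simp add: P_def F_def)
qed

text \<open>By idempotence each nonempty fibre contains exactly one fixed point, so the fibre sizes
  minus one add up to the number of non-fixed points.\<close>

lemma prod_fact_fibres_le:
  fixes \<rho> :: "nat \<Rightarrow> nat"
  assumes idem: "\<And>i. i < t \<Longrightarrow> \<rho> i < t \<and> \<rho> (\<rho> i) = \<rho> i"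
    and small: "\<And>v. card {i. i < t \<and> \<rho> i = v} \<le> n"
  shows "(\<Prod>v\<in>\<rho> ` {..<t}. fact (card {i. i < t \<and> \<rho> i = v})) \<le> rate n ^ card {i. i < t \<and> \<rho> i \<noteq> i}"
proof -
  define F where "F v = {i. i < t \<and> \<rho> i = v}" for v
  have pos: "1 \<le> card (F v)" if "v \<in> \<rho> ` {..<t}" for v
  proof -
    have "finite (F v)" by (simp add: F_def)
    moreover have "F v \<noteq> {}" using that by (auto simp: F_def)
    ultimately show ?thesis by (simp add: Suc_le_eq card_gt_0_iff)
  qed
  have "(\<Sum>v\<in>\<rho> ` {..<t}. card (F v)) = t"
    using sum.group[of "{..<t}" "\<rho> ` {..<t}" \<rho> "\<lambda>_. 1::nat"] by (simp add: F_def)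
  then have "(\<Sum>v\<in>\<rho> ` {..<t}. card (F v) - 1) = t - card (\<rho> ` {..<t})"
    using pos by (subst sum_subtractf_nat) auto
  also have "\<dots> = card {i. i < t \<and> \<rho> i \<noteq> i}"
  proof -
    have "\<rho> ` {..<t} = {..<t} - {i. i < t \<and> \<rho> i \<noteq> i}"
      using idem by force
    moreover have "card {i. i < t \<and> \<rho> i \<noteq> i} \<le> card {..<t}" by (intro card_mono) auto
    ultimately show ?thesis by (simp add: card_Diff_subset subset_iff)
  qed
  finally have exps: "(\<Sum>v\<in>\<rho> ` {..<t}. card (F v) - 1) = card {i. i < t \<and> \<rho> i \<noteq> i}" .
  have "(\<Prod>v\<in>\<rho> ` {..<t}. fact (card (F v))) \<le> (\<Prod>v\<in>\<rho> ` {..<t}. rate n ^ (card (F v) - 1))"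
    using fact_le_rate_power pos small by (intro prod_mono) (auto simp: F_def)
  also have "\<dots> = rate n ^ card {i. i < t \<and> \<rho> i \<noteq> i}"
    by (simp only: power_sum[symmetric] exps)
  finally show ?thesis by (simp add: F_def)
qed

text \<open>Compatibility says that \<open>inv (X c) \<circ> Y c\<close> preserves the fibres of
  \<open>\<rho>\<close> for every column \<open>c\<close>, so a fixed \<open>X\<close> leaves at
  most \<open>card P\<close> choices per column.\<close>

lemma card_compatible_columns:
  assumes X: "X \<in> columns R t"
    and idem: "\<And>i. i < t \<Longrightarrow> \<rho> i < t \<and> \<rho> (\<rho> i) = \<rho> i"
    and small: "\<And>v. card {i. i < t \<and> \<rho> i = v} \<le> n"
  shows "real (card {Y \<in> columns R t. \<forall>(i, j) \<in> linked R t X Y. \<rho> i = \<rho> j})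
    \<le> (rate n ^ card {i. i < t \<and> \<rho> i \<noteq> i}) ^ R"
proof -
  define Q where "Q c = {q. q permutes {..<t} \<and> (\<forall>i<t. \<forall>j<t. X c i = q j \<longrightarrow> \<rho> i = \<rho> j)}" for c
  define P where "P = {p. p permutes {..<t} \<and> (\<forall>i<t. \<rho> (p i) = \<rho> i)}"
  have finP: "finite P" unfolding P_def by (rule finite_subset[OF _ finite_permutations[of "{..<t}"]]) auto
  have finQ: "finite (Q c)" for c
    unfolding Q_def by (rule finite_subset[OF _ finite_permutations[of "{..<t}"]]) auto
  have cardQ: "card (Q c) \<le> card P" if c: "c < R" for c
  proof (rule card_inj_on_le[of "\<lambda>q. inv (X c) \<circ> q"])
    note x = columnsD[OF X c]
    show "inj_on (\<lambda>q. inv (X c) \<circ> q) (Q c)"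
      using permutes_inj[OF permutes_inv[OF x]] by (auto simp: inj_on_def fun_eq_iff dest: injD)
    show "(\<lambda>q. inv (X c) \<circ> q) ` Q c \<subseteq> P"
    proof
      fix p assume "p \<in> (\<lambda>q. inv (X c) \<circ> q) ` Q c"
      then obtain q where q: "q \<in> Q c" "p = inv (X c) \<circ> q" by auto
      have pp: "p permutes {..<t}"
        using q x by (auto simp: Q_def intro: permutes_compose permutes_inv)
      moreover have "X c (p j) = q j" for j
        using q permutes_inverses(1)[OF x] by simp
      moreover have "p j < t" if "j < t" for j using permutes_in_image[OF pp, of j] that by simp
      ultimately show "p \<in> P" using q(1) by (simp add: P_def Q_def)
    qed
  qed (rule finP)
  have "card {Y \<in> columns R t. \<forall>(i, j) \<in> linked R t X Y. \<rho> i = \<rho> j} \<le> card (\<Pi>\<^sub>E c\<in>{..<R}. Q c)"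
    by (intro card_mono finite_PiE) (auto simp: finQ, auto simp: columns_def Q_def linked_def PiE_iff extensional_def)
  also have "\<dots> \<le> (\<Prod>c<R. card P)"
    unfolding card_PiE[OF finite_lessThan] using cardQ by (intro prod_mono) auto
  finally have "real (card {Y \<in> columns R t. \<forall>(i, j) \<in> linked R t X Y. \<rho> i = \<rho> j}) \<le> real (card P) ^ R"
    by (simp flip: of_nat_power)
  moreover have "real (card P) \<le> rate n ^ card {i. i < t \<and> \<rho> i \<noteq> i}"
  proof -
    have "real (card P) \<le> real (\<Prod>v\<in>\<rho> ` {..<t}. fact (card {i. i < t \<and> \<rho> i = v}))"
      using card_fibre_preserving_permutations[of t \<rho>] unfolding P_def by (intro of_nat_mono)
    also have "\<dots> \<le> rate n ^ card {i. i < t \<and> \<rho> i \<noteq> i}"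
      using prod_fact_fibres_le[OF idem small] by (simp add: of_nat_prod)
    finally show ?thesis .
  qed
  then have "real (card P) ^ R \<le> (rate n ^ card {i. i < t \<and> \<rho> i \<noteq> i}) ^ R"
    by (intro power_mono) auto
  ultimately show ?thesis by linarith
qed

text \<open>The shared word has the same index in both tuples, since the label coordinate of the
  hypergraph separates words with different indices.\<close>

definition rivals :: "nat \<Rightarrow> nat \<Rightarrow> (nat \<Rightarrow> nat \<Rightarrow> nat) \<Rightarrow> (nat \<Rightarrow> nat \<Rightarrow> nat) set" where
  "rivals R t X = {Y \<in> columns R t. Y \<noteq> X \<and> (\<exists>q<t. \<forall>c<R. Y c q = X c q)}"

text \<open>
  A labelling sends each word index to the representative of its class. The word shared with a rival
  is a class on its own, so all classes have size at most \<open>t - 1\<close>; this is why the rate for \<open>t - 1\<close>, and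
  not for \<open>t\<close>, controls the number of rivals.
\<close>

definition labellings :: "nat \<Rightarrow> (nat \<Rightarrow> nat) set" where
  "labellings t = {\<rho> \<in> {..<t} \<rightarrow>\<^sub>E {..<t}. (\<forall>i<t. \<rho> (\<rho> i) = \<rho> i) \<and> (\<exists>i<t. \<rho> i \<noteq> i) \<and>
     (\<forall>v. card {i. i < t \<and> \<rho> i = v} \<le> t - 1)}"

text \<open>\<open>\<rho>\<close> picks the least index of each connected component of
  \<open>linked\<close>. The shared word \<open>q\<close> meets no other word of either tuple, as
  columns are injective, so \<open>q\<close> is a component by itself. If all components were single
  indices, every letter of \<open>Y\<close> would sit at the same place in \<open>X\<close>, forcing
  \<open>Y = X\<close>.\<close>

lemma labelling_of_rival:
  assumes X: "X \<in> columns R t" and Y: "Y \<in> rivals R t X" and t: "t \<ge> 2"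
  obtains \<rho> where "\<rho> \<in> labellings t" "\<forall>(i, j) \<in> linked R t X Y. \<rho> i = \<rho> j"
    "\<And>i. i < t \<Longrightarrow> (i, \<rho> i) \<in> (linked R t X Y \<union> (linked R t X Y)\<inverse>)\<^sup>*"
proof -
  define r where "r = (linked R t X Y \<union> (linked R t X Y)\<inverse>)\<^sup>*"
  define \<rho> where "\<rho> i = (LEAST j. (i, j) \<in> r)" for i
  have Yc: "Y \<in> columns R t" using Y by (simp add: rivals_def)
  have refl: "(i, i) \<in> r" for i by (simp add: r_def)
  have "sym r" unfolding r_def by (intro sym_rtrancl) (auto simp: sym_def)
  then have sym: "(j, i) \<in> r" if "(i, j) \<in> r" for i j using that by (auto dest: symD)
  have trans: "(i, l) \<in> r" if "(i, j) \<in> r" "(j, l) \<in> r" for i j l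
    using that unfolding r_def by (rule rtrancl_trans)
  have \<rho>: "(i, \<rho> i) \<in> r" for i unfolding \<rho>_def by (rule LeastI[of _ i]) (rule refl)
  have \<rho>_le: "\<rho> i \<le> i" for i unfolding \<rho>_def by (rule Least_le) (rule refl)
  have \<rho>_eq: "\<rho> i = \<rho> j" if "(i, j) \<in> r" for i j
    unfolding \<rho>_def using that sym trans by metis
  have linked: "(i, j) \<in> r" if "(i, j) \<in> linked R t X Y" for i j
    using that by (auto simp: r_def)
  obtain q where q: "q < t" "\<And>c. c < R \<Longrightarrow> Y c q = X c q" using Y by (auto simp: rivals_def)
  have isolated: "j = q" if "(q, j) \<in> r" for j
    using that unfolding r_def
  proof (induction rule: rtrancl_induct)
    case (step j l)
    then show ?case
      using q columns_inject[OF X] columns_inject[OF Yc] by (auto simp: linked_def) metis+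
  qed simp
  have small: "card {i. i < t \<and> \<rho> i = v} \<le> t - 1" for v
  proof (cases "\<rho> q = v")
    case True
    have "{i. i < t \<and> \<rho> i = v} \<subseteq> {q}"
    proof clarify
      fix i assume "v = \<rho> i"
      then have "(q, \<rho> i) \<in> r" "(\<rho> i, i) \<in> r" using \<rho>[of q] sym[OF \<rho>[of i]] True by auto
      then show "i = q" using trans isolated by blast
    qed
    then have "card {i. i < t \<and> \<rho> i = v} \<le> card {q}" by (intro card_mono) auto
    then show ?thesis using t by simp
  next
    case False
    then have "{i. i < t \<and> \<rho> i = v} \<subseteq> {..<t} - {q}" by auto
    then have "card {i. i < t \<and> \<rho> i = v} \<le> card ({..<t} - {q})" by (intro card_mono) auto
    then show ?thesis using q by simp
  qed
  have nontriv: "\<exists>i<t. \<rho> i \<noteq> i"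
  proof (rule ccontr)
    assume triv: "\<not> (\<exists>i<t. \<rho> i \<noteq> i)"
    have "Y c j = X c j" if "c < R" "j < t" for c j
    proof -
      obtain i where i: "X c i = Y c j" using columnsD[OF X \<open>c < R\<close>] by (metis permutes_surj surjD)
      then have "i < t"
        using permutes_in_image[OF columnsD[OF X \<open>c < R\<close>], of i] columns_less[OF Yc that] by simp
      then have "(i, j) \<in> linked R t X Y" using i that by (auto simp: linked_def)
      then have "\<rho> i = \<rho> j" using \<rho>_eq linked by blast
      then show ?thesis using triv \<open>i < t\<close> that i by auto
    qed
    then have "Y = X" using columns_ext[OF Yc X] by blast
    then show False using Y by (simp add: rivals_def)
  qed
  have lt: "\<rho> i < t" if "i < t" for i using \<rho>_le[of i] that by simp
  have fib: "{i. i < t \<and> restrict \<rho> {..<t} i = v} = {i. i < t \<and> \<rho> i = v}" for v by auto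
  show ?thesis
  proof (rule that[of "restrict \<rho> {..<t}"])
    show "restrict \<rho> {..<t} \<in> labellings t"
      using lt nontriv small \<rho>_eq[OF \<rho>] unfolding labellings_def mem_Collect_eq fib
      by (auto simp: restrict_PiE_iff)
    show "\<forall>(i, j) \<in> linked R t X Y. restrict \<rho> {..<t} i = restrict \<rho> {..<t} j"
      using \<rho>_eq linked by (fastforce simp: linked_def)
  qed (use \<rho> in \<open>auto simp: r_def\<close>)
qed

text \<open>Union bound over labellings. One with \<open>e\<close> non-fixed points admits at most
  \<open>L ^ e\<close> rivals, each colliding for at most a fraction \<open>1 / M ^ e\<close> of the
  weights. Since \<open>e \<ge> 1\<close>, the bound on \<open>M\<close> gives
  \<open>(L / M) ^ e \<le> 1 / (2 * t ^ t)\<close>, and there are at most \<open>t ^ t\<close>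
  labellings.\<close>

lemma sum_collisions_le:
  assumes X: "X \<in> columns R t" and t: "t \<ge> 2" and M: "real M \<ge> 2 * real t ^ t * rate (t - 1) ^ R"
  shows "(\<Sum>Y\<in>rivals R t X. real (card (collisions R t M X Y))) \<le> real M ^ (R * t) / 2"
proof -
  define L where "L = rate (t - 1) ^ R"
  have L: "L \<ge> 1" by (simp add: L_def rate_ge_1)
  have tt: "real t ^ t \<ge> 1" using t by simp
  have M0: "real M > 0" using M L tt by (smt (verit) L_def mult_pos_pos)
  define Z where "Z \<rho> = {Y \<in> rivals R t X. (\<forall>(i, j) \<in> linked R t X Y. \<rho> i = \<rho> j) \<and>
     (\<forall>i<t. (i, \<rho> i) \<in> (linked R t X Y \<union> (linked R t X Y)\<inverse>)\<^sup>*)}" for \<rho>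
  define col where "col Y = real (card (collisions R t M X Y))" for Y
  have fin: "finite (rivals R t X)" unfolding rivals_def by simp
  have finL: "finite (labellings t)"
    unfolding labellings_def by (rule finite_subset[of _ "{..<t} \<rightarrow>\<^sub>E {..<t}"]) (auto intro: finite_PiE)
  have cardL: "card (labellings t) \<le> t ^ t"
  proof -
    have "card (labellings t) \<le> card ({..<t} \<rightarrow>\<^sub>E {..<t})"
      unfolding labellings_def by (intro card_mono finite_PiE) auto
    then show ?thesis by (simp add: card_PiE)
  qed
  have part: "(\<Sum>Y\<in>Z \<rho>. col Y) \<le> real M ^ (R * t) / (2 * real t ^ t)" if \<rho>: "\<rho> \<in> labellings t" for \<rho>
  proof -
    define e where "e = card {i. i < t \<and> \<rho> i \<noteq> i}"
    have e: "e \<ge> 1" using \<rho> by (auto simp: e_def labellings_def Suc_le_eq card_gt_0_iff)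
    have idem: "\<rho> i < t \<and> \<rho> (\<rho> i) = \<rho> i" if "i < t" for i
      using \<rho> that by (auto simp: labellings_def)
    have col: "col Y \<le> real M ^ (R * t) / real M ^ e" if "Y \<in> Z \<rho>" for Y
    proof -
      have "card (collisions R t M X Y) * M ^ e \<le> M ^ (R * t)"
        unfolding e_def using that M0 idem
        by (intro card_collisions[OF X]) (auto simp: Z_def rivals_def)
      then have "col Y * real M ^ e \<le> real M ^ (R * t)"
        unfolding col_def by (simp flip: of_nat_power of_nat_mult)
      then show ?thesis using M0 by (simp add: field_simps)
    qed
    have "real (card (Z \<rho>)) \<le> real (card {Y \<in> columns R t. \<forall>(i, j) \<in> linked R t X Y. \<rho> i = \<rho> j})"
      by (intro of_nat_mono card_mono) (auto simp: Z_def rivals_def)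
    also have "\<dots> \<le> (rate (t - 1) ^ e) ^ R"
      unfolding e_def using \<rho> by (intro card_compatible_columns[OF X idem]) (auto simp: labellings_def)
    also have "\<dots> = L ^ e" by (simp add: L_def mult.commute flip: power_mult)
    finally have cardZ: "real (card (Z \<rho>)) \<le> L ^ e" .
    have "(L / M) ^ e \<le> 1 / (2 * real t ^ t)"
    proof -
      have "L * (2 * real t ^ t) \<le> real M" using M by (simp add: L_def mult_ac)
      then have "L \<le> real M / (2 * real t ^ t)" using tt by (subst pos_le_divide_eq) auto
      then have LM: "L / M \<le> 1 / (2 * real t ^ t)" using M0 by (subst pos_divide_le_eq) auto
      also have "\<dots> \<le> 1" using tt by (subst divide_le_eq_1_pos) linarith+
      finally have "(L / M) ^ e \<le> (L / M) ^ 1"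
        using L M0 e by (intro power_decreasing) auto
      then show ?thesis using LM by simp
    qed
    then have "L ^ e * (real M ^ (R * t) / real M ^ e) \<le> real M ^ (R * t) / (2 * real t ^ t)"
      using M0 mult_left_mono[of "(L / M) ^ e" "1 / (2 * real t ^ t)" "real M ^ (R * t)"]
      by (simp add: power_divide mult_ac)
    moreover have "(\<Sum>Y\<in>Z \<rho>. col Y) \<le> real (card (Z \<rho>)) * (real M ^ (R * t) / real M ^ e)"
      using col by (intro sum_bounded_above) auto
    moreover have "\<dots> \<le> L ^ e * (real M ^ (R * t) / real M ^ e)"
      using cardZ M0 by (intro mult_right_mono) auto
    ultimately show ?thesis by linarith
  qed
  \<comment> \<open>The sets \<open>Z \<rho>\<close> cover the rivals but may overlap; overcounting
    is harmless for an upper bound.\<close>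
  have "(\<Sum>Y\<in>rivals R t X. col Y) \<le> (\<Sum>Y\<in>rivals R t X. \<Sum>\<rho>\<in>labellings t. if Y \<in> Z \<rho> then col Y else 0)"
  proof (rule sum_mono)
    fix Y assume Y: "Y \<in> rivals R t X"
    obtain \<rho> where "\<rho> \<in> labellings t" "Y \<in> Z \<rho>"
    proof (rule labelling_of_rival[OF X Y t])
      fix \<rho> assume "\<rho> \<in> labellings t" "\<forall>(i, j) \<in> linked R t X Y. \<rho> i = \<rho> j"
        "\<And>i. i < t \<Longrightarrow> (i, \<rho> i) \<in> (linked R t X Y \<union> (linked R t X Y)\<inverse>)\<^sup>*"
      with Y that[of \<rho>] show thesis by (simp add: Z_def)
    qed
    then have "col Y = (\<Sum>\<rho>\<in>{\<rho>}. if Y \<in> Z \<rho> then col Y else 0)" by simp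
    also have "\<dots> \<le> (\<Sum>\<rho>\<in>labellings t. if Y \<in> Z \<rho> then col Y else 0)"
      using finL \<open>\<rho> \<in> labellings t\<close> by (intro sum_mono2) (auto simp: col_def)
    finally show "col Y \<le> (\<Sum>\<rho>\<in>labellings t. if Y \<in> Z \<rho> then col Y else 0)" .
  qed
  also have "\<dots> = (\<Sum>\<rho>\<in>labellings t. \<Sum>Y\<in>Z \<rho>. col Y)"
    by (subst sum.swap) (use fin in \<open>auto simp: Z_def sum.inter_filter intro!: sum.cong\<close>)
  also have "\<dots> \<le> real (card (labellings t)) * (real M ^ (R * t) / (2 * real t ^ t))"
    using part by (intro sum_bounded_above) auto
  also have "\<dots> \<le> real (t ^ t) * (real M ^ (R * t) / (2 * real t ^ t))"
    using cardL by (intro mult_right_mono of_nat_mono) auto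
  also have "\<dots> = real M ^ (R * t) / 2" using t by simp
  finally show ?thesis by (simp add: col_def)
qed

section \<open>Isolated tuples\<close>

text \<open>
  The hash of the last word is not constrained: it is determined by the others, since all hashes of a
  tuple add up to the total weight.
\<close>

definition good ::
    "nat \<Rightarrow> nat \<Rightarrow> nat \<Rightarrow> (nat \<times> nat \<Rightarrow> int) \<Rightarrow> (nat \<Rightarrow> int) \<Rightarrow> (nat \<Rightarrow> nat \<Rightarrow> nat) \<Rightarrow> nat \<Rightarrow> bool" where
  "good R t M w u X s \<longleftrightarrow> (\<forall>i<t - 1. [hash R w X i + u i = int s] (mod int M))"

text \<open>One independent offset per constrained word: for fixed weights they make the shifted
  hash values of any tuple uniform modulo \<open>M\<close>.\<close>

definition offsets :: "nat \<Rightarrow> nat \<Rightarrow> (nat \<Rightarrow> int) set" where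
  "offsets t M = {..<t - 1} \<rightarrow>\<^sub>E {0..<int M}"

text \<open>Excluding rivals that are good for the same \<open>s\<close> suffices, because
  mean-freeness first forces a common value in \<open>rainbow_free_isolated\<close>.\<close>

definition isolated ::
    "nat \<Rightarrow> nat \<Rightarrow> nat \<Rightarrow> nat set \<Rightarrow> (nat \<times> nat \<Rightarrow> int) \<Rightarrow> (nat \<Rightarrow> int) \<Rightarrow> ((nat \<Rightarrow> nat \<Rightarrow> nat) \<times> nat) set" where
  "isolated R t M S w u = {(X, s) \<in> columns R t \<times> S.
     good R t M w u X s \<and> (\<forall>Y\<in>rivals R t X. \<not> good R t M w u Y s)}"

lemma finite_offsets [simp]: "finite (offsets t M)"
  unfolding offsets_def by (intro finite_PiE) auto

lemma card_offsets: "card (offsets t M) = M ^ (t - 1)"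
  by (simp add: offsets_def card_PiE)

lemma sum_hash:
  assumes "X \<in> columns R t"
  shows "(\<Sum>i<t. hash R w X i) = (\<Sum>c<R. \<Sum>v<t. w (c, v))"
proof -
  have "(\<Sum>i<t. hash R w X i) = (\<Sum>c<R. \<Sum>i<t. w (c, X c i))"
    unfolding hash_def by (rule sum.swap)
  also have "\<dots> = (\<Sum>c<R. \<Sum>v<t. w (c, v))"
  proof (rule sum.cong[OF refl])
    fix c assume "c \<in> {..<R}"
    then show "(\<Sum>i<t. w (c, X c i)) = (\<Sum>v<t. w (c, v))"
      using sum.permute[OF columnsD[OF assms], of c "\<lambda>v. w (c, v)"] by (simp add: o_def)
  qed
  finally show ?thesis .
qed

lemma sum_hash_init:
  assumes "X \<in> columns R t" "t \<ge> 1"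
  shows "(\<Sum>i<t - 1. hash R w X i) = (\<Sum>c<R. \<Sum>v<t. w (c, v)) - hash R w X (t - 1)"
  using sum_hash[OF assms(1), of w] assms(2) by (cases t) auto

lemma card_good:
  assumes "M > 0"
  shows "M ^ (R * t) \<le> card {(w, u) \<in> weights R t M \<times> offsets t M. good R t M w u X s}"
proof -
  define f where "f w = (w, \<lambda>i\<in>{..<t - 1}. (int s - hash R w X i) mod int M)" for w
  have inj: "inj_on f (weights R t M)" by (auto simp: inj_on_def f_def)
  have "snd (f w) \<in> offsets t M" for w
    using assms unfolding f_def offsets_def snd_conv restrict_PiE_iff by simp
  moreover have "good R t M w (snd (f w)) X s" for w
    by (simp add: f_def good_def cong_def mod_add_right_eq)
  ultimately have "f ` weights R t M \<subseteq> {(w, u) \<in> weights R t M \<times> offsets t M. good R t M w u X s}"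
    by (auto simp: f_def)
  moreover have "finite {(w, u) \<in> weights R t M \<times> offsets t M. good R t M w u X s}"
    by (rule finite_subset[of _ "weights R t M \<times> offsets t M"]) auto
  ultimately show ?thesis
    unfolding card_weights[symmetric] by (intro card_inj_on_le[OF inj])
qed

text \<open>Goodness of \<open>X\<close> determines the offsets from the weights, so projecting to
  weights is injective. If both tuples are good, their first \<open>t - 1\<close> hashes agree, and
  the fixed total makes the last ones agree too.\<close>

lemma card_both_good:
  assumes X: "X \<in> columns R t" and Y: "Y \<in> columns R t" and t: "t \<ge> 1"
  shows "card {(w, u) \<in> weights R t M \<times> offsets t M. good R t M w u X s \<and> good R t M w u Y s}
    \<le> card (collisions R t M X Y)"
proof (rule card_inj_on_le[of fst])
  show "inj_on fst {(w, u) \<in> weights R t M \<times> offsets t M. good R t M w u X s \<and> good R t M w u Y s}"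
  proof (rule inj_onI, clarsimp)
    fix w u u'
    assume u: "u \<in> offsets t M" "u' \<in> offsets t M"
      and g: "good R t M w u X s" "good R t M w u' X s"
    have "u i = u' i" if i: "i < t - 1" for i
    proof -
      have "[hash R w X i + u i = hash R w X i + u' i] (mod int M)"
        using g i unfolding good_def by (meson cong_sym cong_trans)
      then have "[u i = u' i] (mod int M)" by (simp add: cong_add_lcancel)
      moreover have "u i \<in> {0..<int M}" "u' i \<in> {0..<int M}" 
        using PiE_mem[OF u(1)[unfolded offsets_def], of i] PiE_mem[OF u(2)[unfolded offsets_def], of i] i
        by simp_all
      ultimately show ?thesis by (simp add: cong_def)
    qed
    then show "u = u'" using u unfolding offsets_def by (blast intro: PiE_ext)
  qed
  show "fst ` {(w, u) \<in> weights R t M \<times> offsets t M. good R t M w u X s \<and> good R t M w u Y s}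
      \<subseteq> collisions R t M X Y"
  proof clarsimp
    fix w u
    assume w: "w \<in> weights R t M" and gX: "good R t M w u X s" and gY: "good R t M w u Y s"
    have init: "[hash R w X i = hash R w Y i] (mod int M)" if "i < t - 1" for i
    proof -
      have "[hash R w X i + u i = hash R w Y i + u i] (mod int M)"
        using gX gY that unfolding good_def by (meson cong_sym cong_trans)
      then show ?thesis by (simp add: cong_add_rcancel)
    qed
    have "[(\<Sum>i<t - 1. hash R w X i) = (\<Sum>i<t - 1. hash R w Y i)] (mod int M)"
      using init by (intro cong_sum) auto
    then have "[- hash R w X (t - 1) = - hash R w Y (t - 1)] (mod int M)"
      unfolding sum_hash_init[OF X t] sum_hash_init[OF Y t] diff_conv_add_uminus
      by (simp only: cong_add_lcancel)
    then have "[hash R w X (t - 1) = hash R w Y (t - 1)] (mod int M)"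
      by (simp add: cong_minus_minus_iff)
    then have "[hash R w X i = hash R w Y i] (mod int M)" if "i < t" for i
      using init that by (cases "i = t - 1") auto
    then show "w \<in> collisions R t M X Y" using w by (simp add: collisions_def)
  qed
qed (simp add: collisions_def)

text \<open>Averaging over weights and offsets. A fixed pair is good for at least
  \<open>M ^ (R * t)\<close> choices, and good rivals spoil at most half that number. The double
  count is run by contradiction: if every choice fell short of the average, so would the
  total.\<close>

lemma exists_many_isolated:
  assumes t: "t \<ge> 2" and M: "real M \<ge> 2 * real t ^ t * rate (t - 1) ^ R" and S: "finite S"
  obtains w u where "real (fact t ^ R * card S) \<le> 2 * real M ^ (t - 1) * real (card (isolated R t M S w u))"
proof (rule ccontr)
  assume neg: "\<not> thesis"
  have M0: "M > 0"
  proof (rule ccontr)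
    assume "\<not> M > 0"
    moreover have "0 < 2 * real t ^ t * rate (t - 1) ^ R"
      using t rate_ge_1[of "t - 1"] by (intro mult_pos_pos zero_less_power) auto
    ultimately show False using M by simp
  qed
  define \<Theta> where "\<Theta> = weights R t M \<times> offsets t M"
  define C where "C = columns R t \<times> S"
  define iso where "iso \<theta> p \<longleftrightarrow> p \<in> isolated R t M S (fst \<theta>) (snd \<theta>)" for \<theta> p
  have fin: "finite \<Theta>" "finite C" using S by (auto simp: \<Theta>_def C_def)
  have card_\<Theta>: "card \<Theta> = M ^ (R * t) * M ^ (t - 1)"
    by (simp add: \<Theta>_def card_cartesian_product card_weights card_offsets)
  have card_C: "card C = fact t ^ R * card S"
    by (simp add: C_def card_cartesian_product card_columns)
  have low: "real M ^ (R * t) / 2 \<le> real (card {\<theta> \<in> \<Theta>. iso \<theta> p})" if p: "p \<in> C" for p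
  proof -
    obtain X s where Xs: "p = (X, s)" "X \<in> columns R t" "s \<in> S" using p by (auto simp: C_def)
    define G where "G = {(w, u) \<in> weights R t M \<times> offsets t M. good R t M w u X s}"
    define B where "B Y = {(w, u) \<in> weights R t M \<times> offsets t M. good R t M w u X s \<and> good R t M w u Y s}" for Y
    have finr: "finite (rivals R t X)" by (simp add: rivals_def)
    have G: "G \<subseteq> {\<theta> \<in> \<Theta>. iso \<theta> p} \<union> (\<Union>Y\<in>rivals R t X. B Y)"
      using Xs by (auto simp: G_def B_def \<Theta>_def iso_def isolated_def)
    have finB: "finite (B Y)" for Y
      unfolding B_def by (rule finite_subset[of _ "weights R t M \<times> offsets t M"]) auto
    have "M ^ (R * t) \<le> card G" unfolding G_def by (rule card_good[OF M0])
    also have "\<dots> \<le> card ({\<theta> \<in> \<Theta>. iso \<theta> p} \<union> (\<Union>Y\<in>rivals R t X. B Y))"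
      using G fin finr finB by (intro card_mono) auto
    also have "\<dots> \<le> card {\<theta> \<in> \<Theta>. iso \<theta> p} + card (\<Union>Y\<in>rivals R t X. B Y)" by (rule card_Un_le)
    also have "card (\<Union>Y\<in>rivals R t X. B Y) \<le> (\<Sum>Y\<in>rivals R t X. card (B Y))"
      by (rule card_UN_le[OF finr])
    also have "\<dots> \<le> (\<Sum>Y\<in>rivals R t X. card (collisions R t M X Y))"
      unfolding B_def using Xs t by (intro sum_mono card_both_good) (auto simp: rivals_def)
    finally have "real (M ^ (R * t)) \<le>
        real (card {\<theta> \<in> \<Theta>. iso \<theta> p} + (\<Sum>Y\<in>rivals R t X. card (collisions R t M X Y)))"
      by (intro of_nat_mono) simp
    then show ?thesis using sum_collisions_le[OF Xs(2) t M] by simp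
  qed
  have up: "2 * real M ^ (t - 1) * real (card {p \<in> C. iso \<theta> p}) < real (card C)" for \<theta>
  proof -
    have "{p \<in> C. iso \<theta> p} = isolated R t M S (fst \<theta>) (snd \<theta>)"
      by (auto simp: iso_def isolated_def C_def)
    then show ?thesis using neg that unfolding card_C by (metis not_le)
  qed
  have "real (card C) * (real M ^ (R * t) / 2) \<le> (\<Sum>p\<in>C. real (card {\<theta> \<in> \<Theta>. iso \<theta> p}))"
    using low by (intro sum_bounded_below) auto
  also have "\<dots> = (\<Sum>p\<in>C. \<Sum>\<theta>\<in>\<Theta>. if iso \<theta> p then 1 else 0)"
    using fin by (simp add: sum.inter_filter[symmetric])
  also have "\<dots> = (\<Sum>\<theta>\<in>\<Theta>. \<Sum>p\<in>C. if iso \<theta> p then 1 else 0)" by (rule sum.swap)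
  also have "\<dots> = (\<Sum>\<theta>\<in>\<Theta>. real (card {p \<in> C. iso \<theta> p}))"
    using fin by (simp add: sum.inter_filter[symmetric])
  finally have "2 * real M ^ (t - 1) * (real (card C) * (real M ^ (R * t) / 2)) \<le>
      (\<Sum>\<theta>\<in>\<Theta>. 2 * real M ^ (t - 1) * real (card {p \<in> C. iso \<theta> p}))"
    unfolding sum_distrib_left[symmetric] by (rule mult_left_mono) simp
  also have "\<dots> < (\<Sum>\<theta>\<in>\<Theta>. real (card C))"
  proof (rule sum_strict_mono[OF fin(1) _ up])
    show "\<Theta> \<noteq> {}" using card_\<Theta> M0 by auto
  qed
  finally show False using card_\<Theta> by (simp add: mult_ac)
qed

section \<open>Rainbow matchings of isolated tuples\<close>

text \<open>Word \<open>i\<close> of \<open>Y\<close> is taken from position \<open>i\<close> of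
  \<open>Z i\<close>: with the label coordinate added, \<open>t\<close> disjoint edges carry
  distinct labels, so this is the theorem's condition in terms of tuples.\<close>

definition rainbow_free :: "nat \<Rightarrow> nat \<Rightarrow> (nat \<Rightarrow> nat \<Rightarrow> nat) set \<Rightarrow> bool" where
  "rainbow_free R t \<X> \<longleftrightarrow> \<X> \<subseteq> columns R t \<and>
     (\<forall>Z. \<forall>Y\<in>columns R t. (\<forall>i<t. Z i \<in> \<X> \<and> (\<forall>c<R. Y c i = Z i c i)) \<longrightarrow> (\<forall>i<t. Z i = Y))"

text \<open>\<open>Y\<close> and \<open>Z (t - 1)\<close> share their last word and all tuples have
  the same total hash, so their first \<open>t - 1\<close> hashes have equal sums. Thus the first
  \<open>t - 1\<close> values \<open>\<sigma> i\<close> have mean \<open>\<sigma> (t - 1)\<close>,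
  and mean-freeness makes all values equal. Then \<open>Y\<close> is good for the common value;
  sharing word \<open>i\<close> with the isolated \<open>Z i\<close>, it must be
  \<open>Z i\<close>.\<close>

lemma rainbow_free_isolated:
  assumes t: "t \<ge> 2" and S: "mean_free (t - 1) M S"
  shows "rainbow_free R t (fst ` isolated R t M S w u)"
  unfolding rainbow_free_def
proof (intro conjI allI ballI impI)
  fix Z Y i
  assume Y: "Y \<in> columns R t" and "i < t"
    and ZY: "\<forall>i<t. Z i \<in> fst ` isolated R t M S w u \<and> (\<forall>c<R. Y c i = Z i c i)"
  have "\<forall>i. \<exists>s. i < t \<longrightarrow> (Z i, s) \<in> isolated R t M S w u" using ZY by force
  then obtain \<sigma> where \<sigma>: "\<And>i. i < t \<Longrightarrow> (Z i, \<sigma> i) \<in> isolated R t M S w u" by metis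
  have hash_eq: "hash R w (Z i) i = hash R w Y i" if "i < t" for i
    using ZY that by (simp add: hash_def)
  have own: "[hash R w Y i + u i = int (\<sigma> i)] (mod int M)" if "i < t - 1" for i
  proof -
    have "i < t" using that by simp
    have "[hash R w (Z i) i + u i = int (\<sigma> i)] (mod int M)"
      using \<sigma>[OF \<open>i < t\<close>] that unfolding isolated_def good_def by blast
    then show ?thesis using hash_eq[OF \<open>i < t\<close>] by simp
  qed
  have last: "[hash R w (Z (t - 1)) i + u i = int (\<sigma> (t - 1))] (mod int M)" if "i < t - 1" for i
    using \<sigma>[of "t - 1"] t that by (auto simp: isolated_def good_def)
  have "(\<Sum>i<t - 1. hash R w (Z (t - 1)) i) = (\<Sum>i<t - 1. hash R w Y i)"
    using sum_hash_init[OF Y, of w] sum_hash_init[of "Z (t - 1)" R t w] \<sigma>[of "t - 1"] t hash_eq[of "t - 1"]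
    by (auto simp: isolated_def)
  then have "(\<Sum>i<t - 1. hash R w Y i + u i) = (\<Sum>i<t - 1. hash R w (Z (t - 1)) i + u i)"
    by (simp add: sum.distrib)
  moreover have "[(\<Sum>i<t - 1. hash R w Y i + u i) = (\<Sum>i<t - 1. int (\<sigma> i))] (mod int M)"
    using own by (intro cong_sum) auto
  moreover have "[(\<Sum>i<t - 1. hash R w (Z (t - 1)) i + u i) = (\<Sum>i<t - 1. int (\<sigma> (t - 1)))] (mod int M)"
    using last by (intro cong_sum) auto
  ultimately have "[(\<Sum>i<t - 1. int (\<sigma> i)) = int (t - 1) * int (\<sigma> (t - 1))] (mod int M)"
    by (simp add: cong_def)
  moreover have "\<sigma> i \<in> S" if "i < t" for i using \<sigma>[OF that] by (simp add: isolated_def)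
  ultimately have "\<forall>i<t - 1. \<sigma> i = \<sigma> (t - 1)"
    using S t unfolding mean_free_def by auto
  then have \<sigma>_eq: "\<sigma> i = \<sigma> (t - 1)" if "i < t" for i using that by (cases "i = t - 1") auto
  have "good R t M w u Y (\<sigma> i)"
    unfolding good_def
  proof (intro allI impI)
    fix l assume l: "l < t - 1"
    then have "\<sigma> l = \<sigma> i" using \<sigma>_eq[of l] \<sigma>_eq[OF \<open>i < t\<close>] by linarith
    with own[OF l] show "[hash R w Y l + u l = int (\<sigma> i)] (mod int M)" by metis
  qed
  then have "Y \<notin> rivals R t (Z i)" using \<sigma>[OF \<open>i < t\<close>] by (auto simp: isolated_def)
  moreover have "\<exists>q<t. \<forall>c<R. Y c q = Z i c q" using ZY \<open>i < t\<close> by blast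
  ultimately show "Z i = Y" using Y unfolding rivals_def by blast
qed (auto simp: isolated_def)

text \<open>The hash of word 0, constrained because \<open>t \<ge> 2\<close>, recovers
  \<open>s\<close>; hence there are as many tuples as pairs.\<close>

lemma inj_on_fst_isolated:
  assumes t: "t \<ge> 2" and S: "S \<subseteq> {..<M}"
  shows "inj_on fst (isolated R t M S w u)"
proof (rule inj_onI, clarsimp)
  fix X s s' assume "(X, s) \<in> isolated R t M S w u" "(X, s') \<in> isolated R t M S w u"
  then have "[hash R w X 0 + u 0 = int s] (mod int M)" "[hash R w X 0 + u 0 = int s'] (mod int M)"
    and "s < M" "s' < M"
    using t S by (auto simp: isolated_def good_def)
  then show "s = s'" by (simp add: cong_def)
qed

section \<open>The hypergraph\<close>

text \<open>Coordinate \<open>R\<close> carries the label, and vertex \<open>c * t + v\<close> encodes letter \<open>v\<close> in coordinate \<open>c\<close>.\<close>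

definition letter :: "nat \<Rightarrow> (nat \<Rightarrow> nat \<Rightarrow> nat) \<Rightarrow> nat \<Rightarrow> nat \<Rightarrow> nat" where
  "letter R X i c = (if c < R then X c i else i)"

definition edge :: "nat \<Rightarrow> nat \<Rightarrow> (nat \<Rightarrow> nat \<Rightarrow> nat) \<Rightarrow> nat \<Rightarrow> nat set" where
  "edge R t X i = (\<lambda>c. c * t + letter R X i c) ` {..R}"

lemma letter_less: "X \<in> columns R t \<Longrightarrow> i < t \<Longrightarrow> letter R X i c < t"
  by (simp add: letter_def columns_less)

lemma encode_inject:
  fixes v v' t :: nat
  assumes "v < t" "v' < t"
  shows "c * t + v = c' * t + v' \<longleftrightarrow> c = c' \<and> v = v'"
proof
  assume eq: "c * t + v = c' * t + v'"
  have "(c * t + v) div t = c" "(c' * t + v') div t = c'" using assms by simp_all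
  with eq have "c = c'" by simp
  with eq show "c = c' \<and> v = v'" by simp
qed simp

lemma disjoint_edges_iff:
  assumes "X \<in> columns R t" "Z \<in> columns R t" "i < t" "j < t"
  shows "edge R t X i \<inter> edge R t Z j = {} \<longleftrightarrow> (\<forall>c\<le>R. letter R X i c \<noteq> letter R Z j c)"
  unfolding edge_def
  using letter_less[OF assms(1,3)] letter_less[OF assms(2,4)]
  by (fastforce simp: encode_inject)

lemma card_edge:
  assumes "X \<in> columns R t" "i < t"
  shows "card (edge R t X i) = R + 1"
proof -
  have "inj_on (\<lambda>c. c * t + letter R X i c) {..R}"
    using letter_less[OF assms] by (auto simp: inj_on_def encode_inject)
  then show ?thesis by (simp add: edge_def card_image)
qed

lemma edge_subset:
  assumes "X \<in> columns R t" "i < t"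
  shows "edge R t X i \<subseteq> {..<t * (R + 1)}"
proof -
  have "c * t + letter R X i c < t * (R + 1)" if "c \<le> R" for c
  proof -
    have "c * t + letter R X i c < (c + 1) * t" using letter_less[OF assms, of c] by simp
    also have "\<dots> \<le> (R + 1) * t" using that by (intro mult_right_mono) auto
    finally show ?thesis by (simp add: mult.commute)
  qed
  then show ?thesis by (auto simp: edge_def)
qed

lemma edge_inter_block:
  assumes "X \<in> columns R t" "i < t" "c \<le> R"
  shows "edge R t X i \<inter> {c * t..<(c + 1) * t} = {c * t + letter R X i c}"
proof -
  have block: "x \<in> {c * t..<(c + 1) * t} \<longleftrightarrow> x div t = c" for x
  proof
    assume "x \<in> {c * t..<(c + 1) * t}"
    then show "x div t = c" by (intro div_nat_eqI) (auto simp: mult.commute)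
  next
    assume "x div t = c"
    then show "x \<in> {c * t..<(c + 1) * t}"
      using assms(2) div_times_less_eq_dividend[of x t] dividend_less_div_times[of t x] by auto
  qed
  have "(a * t + letter R X i a) div t = a" for a using letter_less[OF assms(1,2), of a] by simp
  moreover have "{c * t..<(c + 1) * t} = {x. x div t = c}" using block by blast
  ultimately show ?thesis using assms(3) by (auto simp: edge_def)
qed

lemma edge_inject:
  assumes "X \<in> columns R t" "i < t" "j < t" "edge R t X i = edge R t X j"
  shows "i = j"
proof (rule ccontr)
  assume "i \<noteq> j"
  then have "edge R t X i \<inter> edge R t X j = {}"
    using assms by (subst disjoint_edges_iff) (auto simp: letter_def columns_inject)
  then show False using assms card_edge[OF assms(1,2)] by auto
qed

text \<open>Coordinate \<open>R\<close> forces \<open>t\<close> disjoint edges to carry all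
  \<open>t\<close> labels. Sorted by label they form a tuple in \<open>columns R t\<close>, as
  disjointness makes the letters in each column distinct, and \<open>rainbow_free\<close>
  applies.\<close>

lemma hypergraph_of_rainbow_free:
  assumes t: "t \<ge> 2" and free: "rainbow_free R t \<X>"
  shows "\<exists>(V :: nat set) (E :: nat set set) (M :: nat \<Rightarrow> nat set set).
         hypergraph V E \<and> uniform (R + 1) E \<and> partite (R + 1) V E \<and> card V = t * (R + 1) \<and>
         (\<forall>k\<in>{1..card \<X>}. matching E (M k) \<and> card (M k) = t) \<and>
         (\<forall>(j :: nat \<Rightarrow> nat) (e :: nat \<Rightarrow> nat set).
            (\<forall>i\<in>{1..t}. j i \<in> {1..card \<X>} \<and> e i \<in> M (j i)) \<and> disjoint_family_on e {1..t} \<longrightarrow>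
            (\<forall>i\<in>{1..t}. \<forall>i'\<in>{1..t}. j i = j i'))"
proof -
  define E where "E = (\<lambda>(X, i). edge R t X i) ` (columns R t \<times> {..<t})"
  have sub: "\<X> \<subseteq> columns R t" using free by (simp add: rainbow_free_def)
  then have "finite \<X>" by (rule finite_subset) simp
  then obtain h where h: "bij_betw h {1..card \<X>} \<X>" using ex_bij_betw_nat_finite_1 by blast
  have hX: "h k \<in> \<X>" "h k \<in> columns R t" if "k \<in> {1..card \<X>}" for k
    using bij_betwE[OF h] that sub by auto
  define M where "M k = edge R t (h k) ` {..<t}" for k
  have "hypergraph {..<t * (R + 1)} E"
    using edge_subset by (fastforce simp: hypergraph_def E_def)
  moreover have "uniform (R + 1) E"
    using card_edge by (fastforce simp: uniform_def E_def)
  \<comment> \<open>Part \<open>p\<close> is block \<open>p - 1\<close> of \<open>t\<close>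
    consecutive vertices, as parts are numbered from 1.\<close>
  moreover have "partite (R + 1) {..<t * (R + 1)} E"
    unfolding partite_def
  proof (intro exI[of _ "\<lambda>p. {(p - 1) * t..<p * t}"] conjI ballI)
    show "disjoint_family_on (\<lambda>p. {(p - 1) * t..<p * t}) {1..R + 1}"
    proof -
      have "{(p - 1) * t..<p * t} \<inter> {(q - 1) * t..<q * t} = {}" if "p < q" for p q
      proof -
        have "p * t \<le> (q - 1) * t" using that by (intro mult_right_mono) auto
        then show ?thesis by auto
      qed
      then show ?thesis unfolding disjoint_family_on_def by (metis Int_commute linorder_neqE_nat)
    qed
    show "(\<Union>p\<in>{1..R + 1}. {(p - 1) * t..<p * t}) = {..<t * (R + 1)}"
    proof (intro equalityI subsetI)
      fix x assume "x \<in> (\<Union>p\<in>{1..R + 1}. {(p - 1) * t..<p * t})"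
      then obtain p where "p \<le> R + 1" "x < p * t" by auto
      moreover have "p * t \<le> (R + 1) * t" using \<open>p \<le> R + 1\<close> by (intro mult_right_mono) auto
      ultimately show "x \<in> {..<t * (R + 1)}" by (simp add: mult.commute)
    next
      fix x assume "x \<in> {..<t * (R + 1)}"
      then have "x div t < R + 1" using t by (simp add: div_less_iff_less_mult mult.commute)
      moreover have "x < (x div t + 1) * t" using t dividend_less_div_times[of t x] by simp
      moreover have "(x div t + 1 - 1) * t \<le> x" by simp
      ultimately show "x \<in> (\<Union>p\<in>{1..R + 1}. {(p - 1) * t..<p * t})"
        by (intro UN_I[of "x div t + 1"]) auto
    qed
    fix e p assume "e \<in> E" "p \<in> {1..R + 1}"
    then show "card (e \<inter> {(p - 1) * t..<p * t}) = 1"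
      using edge_inter_block[of _ R t _ "p - 1"] by (auto simp: E_def)
  qed
  moreover have "card {..<t * (R + 1)} = t * (R + 1)" by simp
  moreover have "matching E (M k) \<and> card (M k) = t" if k: "k \<in> {1..card \<X>}" for k
  proof
    note hk = hX(2)[OF k]
    show "card (M k) = t"
      unfolding M_def using edge_inject[OF hk] by (subst card_image) (auto simp: inj_on_def)
    have "edge R t (h k) i \<inter> edge R t (h k) j = {}" if "i < t" "j < t" "i \<noteq> j" for i j
      using that disjoint_edges_iff[OF hk hk] by (auto simp: letter_def columns_inject[OF hk])
    then show "matching E (M k)"
      using hk unfolding matching_def disjoint_def M_def E_def
      by (intro conjI image_subsetI ballI impI) auto
  qed
  moreover have "\<forall>i\<in>{1..t}. \<forall>i'\<in>{1..t}. j i = j i'"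
    if e: "\<forall>i\<in>{1..t}. j i \<in> {1..card \<X>} \<and> e i \<in> M (j i)" and disj: "disjoint_family_on e {1..t}"
    for j :: "nat \<Rightarrow> nat" and e
  proof -
    have "\<forall>i\<in>{1..t}. \<exists>p<t. e i = edge R t (h (j i)) p" using e by (auto simp: M_def)
    then obtain p where p: "\<And>i. i \<in> {1..t} \<Longrightarrow> p i < t \<and> e i = edge R t (h (j i)) (p i)" by metis
    have differ: "letter R (h (j a)) (p a) c \<noteq> letter R (h (j b)) (p b) c"
      if "a \<in> {1..t}" "b \<in> {1..t}" "a \<noteq> b" "c \<le> R" for a b c
    proof -
      have "e a \<inter> e b = {}" using disj that by (auto simp: disjoint_family_on_def)
      then show ?thesis using p e that hX(2) disjoint_edges_iff by auto
    qed
    have "inj_on p {1..t}"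
      using differ[of _ _ R] by (force simp: inj_on_def letter_def)
    moreover from this have "p ` {1..t} = {..<t}"
      by (intro card_subset_eq) (use p in \<open>auto simp: card_image\<close>)
    ultimately have "bij_betw p {1..t} {..<t}" by (simp add: bij_betw_def)
    note bij = this
    \<comment> \<open>The edge carrying label \<open>i\<close> is the one with index
      \<open>q i\<close>.\<close>
    define q where "q = inv_into {1..t} p"
    have q: "q i \<in> {1..t} \<and> p (q i) = i" if "i < t" for i
      using bij_betwE[OF bij_betw_inv_into[OF bij]] bij_betw_inv_into_right[OF bij] that by (simp add: q_def)
    have qp: "q (p i) = i" if "i \<in> {1..t}" for i
      using bij_betw_inv_into_left[OF bij that] by (simp add: q_def)
    define Z where "Z i = h (j (q i))" for i
    have Z: "Z i \<in> \<X>" "Z i \<in> columns R t" if "i < t" for i using hX e q[OF that] by (auto simp: Z_def)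
    \<comment> \<open>Outside \<open>{..<t}\<close> each column is the identity, as
      \<open>permutes\<close> demands.\<close>
    define Y where "Y = (\<lambda>c\<in>{..<R}. \<lambda>i. if i < t then Z i c i else i)"
    have "(\<lambda>i. if i < t then Z i c i else i) permutes {..<t}" if c: "c < R" for c
    proof (rule bij_imp_permutes)
      have "a = b" if "a < t" "b < t" "Z a c a = Z b c b" for a b
      proof (rule ccontr)
        assume "a \<noteq> b"
        then have "q a \<noteq> q b" using q[OF that(1)] q[OF that(2)] by metis
        then show False
          using differ[of "q a" "q b" c] q[OF that(1)] q[OF that(2)] that(3) c by (simp add: letter_def Z_def)
      qed
      then have inj: "inj_on (\<lambda>i. if i < t then Z i c i else i) {..<t}" by (auto simp: inj_on_def)
      have into: "(\<lambda>i. if i < t then Z i c i else i) ` {..<t} \<subseteq> {..<t}"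
        using columns_less[OF Z(2) c] by auto
      show "bij_betw (\<lambda>i. if i < t then Z i c i else i) {..<t} {..<t}"
        unfolding bij_betw_def using inj endo_inj_surj[OF finite_lessThan into inj] by (rule conjI)
    qed auto
    then have "Y \<in> columns R t" by (simp add: Y_def columns_def restrict_PiE_iff)
    moreover have "\<forall>i<t. Z i \<in> \<X> \<and> (\<forall>c<R. Y c i = Z i c i)" using Z by (simp add: Y_def)
    ultimately have "\<forall>i<t. Z i = Y" using free unfolding rainbow_free_def by blast
    then have "h (j i) = Y" if "i \<in> {1..t}" for i
      using p[OF that] qp[OF that] unfolding Z_def by metis
    then show ?thesis using e inj_onD[OF bij_betw_imp_inj_on[OF h]] by metis
  qed
  ultimately show ?thesis by blast
qed

section \<open>Choice of parameters and the final bound\<close>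

text \<open>The modulus of the Behrend set for \<open>n = t - 1\<close> doubles as the hash modulus;
  it is at least \<open>d ^ k\<close>, so the hypothesis makes it large enough for
  \<open>exists_many_isolated\<close>.\<close>

lemma exists_large_rainbow_free:
  fixes t R k d :: nat
  assumes t: "t \<ge> 2" and k: "k \<ge> 1" and d: "d \<ge> 1" and Q: "2 * real t ^ t * rate (t - 1) ^ R \<le> real d ^ k"
  obtains \<X> where "rainbow_free R t \<X>"
    "real (fact t ^ R * d ^ k) \<le> 2 * (real k * (real d)\<^sup>2) * real (((t - 1) * d) ^ k) ^ (t - 1) * real (card \<X>)"
proof -
  define M where "M = ((t - 1) * d) ^ k"
  obtain S where S: "S \<subseteq> {..<M}" "mean_free (t - 1) M S" "d ^ k \<le> k * d\<^sup>2 * card S"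
  proof (rule behrend[of "t - 1" d k])
    show "t - 1 \<ge> 1" using t by simp
  qed (use k d that in \<open>auto simp: M_def\<close>)
  have "real d ^ k \<le> real M"
  proof -
    have "1 * d \<le> (t - 1) * d" using t by (intro mult_right_mono) auto
    then have "d ^ k \<le> M" unfolding M_def by (intro power_mono) auto
    then show ?thesis by (simp flip: of_nat_power)
  qed
  then have M: "real M \<ge> 2 * real t ^ t * rate (t - 1) ^ R" using Q by linarith
  have finS: "finite S" using S(1) finite_subset by blast
  obtain w u where wu: "real (fact t ^ R * card S) \<le> 2 * real M ^ (t - 1) * real (card (isolated R t M S w u))"
    using exists_many_isolated[OF t M finS] .
  show ?thesis
  proof (rule that)
    show "rainbow_free R t (fst ` isolated R t M S w u)" by (rule rainbow_free_isolated[OF t S(2)])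
    have "real (fact t ^ R * d ^ k) \<le> real (fact t ^ R * (k * d\<^sup>2 * card S))"
      using S(3) by (intro of_nat_mono mult_left_mono) auto
    also have "\<dots> = (real k * (real d)\<^sup>2) * real (fact t ^ R * card S)" by simp
    also have "\<dots> \<le> (real k * (real d)\<^sup>2) * (2 * real M ^ (t - 1) * real (card (isolated R t M S w u)))"
      by (intro mult_left_mono wu) auto
    finally show "real (fact t ^ R * d ^ k) \<le>
        2 * (real k * (real d)\<^sup>2) * real (((t - 1) * d) ^ k) ^ (t - 1) * real (card (fst ` isolated R t M S w u))"
      unfolding card_image[OF inj_on_fst_isolated[OF t S(1)]] M_def[symmetric] by (simp add: mult_ac)
  qed
qed

text \<open>The total loss is \<open>loss t ^ k\<close>. The outer \<open>t\<close> pays for the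
  label coordinate, the factor with 16 for the halving, for \<open>k \<le> 2 ^ k\<close> and for
  \<open>d\<^sup>2\<close>, and the rest for constants in the power of the modulus.\<close>

definition loss :: "nat \<Rightarrow> real" where
  "loss t = real t * (16 * (2 * real t ^ t * rate (t - 1))\<^sup>2 * real (t - 1) *
     (2 * real (t - 1) * (2 * real t ^ t)) ^ (t - 2))"

text \<open>With \<open>n = t - 1\<close>, the modulus costs
  \<open>(rate n ^ (n - 1)) ^ R = fact n ^ R\<close>, and dividing \<open>fact t ^ R\<close> by it
  leaves \<open>t ^ R\<close>. All remaining factors are at most exponential in
  \<open>k\<close>.\<close>

lemma exists_rainbow_free_of_rate:
  fixes t R k :: nat
  assumes t: "t \<ge> 2" and R: "R \<ge> 1" and k: "k \<ge> 1" "R \<le> k\<^sup>2"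
  obtains \<X> where "rainbow_free R t \<X>" "real t ^ (R + 1) \<le> loss t ^ k * real (card \<X>)"
proof -
  define n where "n = t - 1"
  define c where "c = 2 * real t ^ t"
  define K where "K = c * rate n"
  define Q where "Q = c * rate n ^ R"
  \<comment> \<open>The \<open>k\<close>-th root of the required modulus, rounded up; as the root is
    at least 1, rounding at most doubles it.\<close>
  define d where "d = nat \<lceil>root k Q\<rceil>"
  have n: "n \<ge> 1" and tn: "t = Suc n" using t by (auto simp: n_def)
  have rate: "rate n \<ge> 1" by (rule rate_ge_1)
  have "1 \<le> real t ^ t" using t by simp
  then have c: "c \<ge> 1" by (simp add: c_def)
  have K: "K \<ge> 1" using mult_mono[of 1 c 1 "rate n"] c rate by (simp add: K_def)
  have Q1: "Q \<ge> 1" 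
    using mult_mono[of 1 c 1 "rate n ^ R"] c one_le_power[OF rate, of R] by (simp add: Q_def)
  have rQ: "root k Q \<ge> 1" "root k Q ^ k = Q" using Q1 k by (simp_all add: real_root_ge_1_iff)
  have d_low: "root k Q \<le> real d" unfolding d_def by linarith
  have d_up: "real d \<le> 2 * root k Q" unfolding d_def using rQ(1) by linarith
  have d1: "d \<ge> 1" using d_low rQ(1) by linarith
  have Qd: "Q \<le> real d ^ k" using power_mono[OF d_low, of k] rQ by simp
  have dQ: "real d ^ k \<le> 2 ^ k * Q" using power_mono[OF d_up, of k] rQ by (simp add: power_mult_distrib)
  \<comment> \<open>Here \<open>R \<le> k\<^sup>2\<close> enters: it bounds \<open>root k Q\<close>
    by \<open>K ^ k\<close>, so that \<open>d\<^sup>2\<close> is at most exponential in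
    \<open>k\<close>.\<close>
  have "Q \<le> c ^ R * rate n ^ R"
    unfolding Q_def using c R rate by (intro mult_right_mono self_le_power) auto
  also have "\<dots> = K ^ R" by (simp add: K_def power_mult_distrib)
  also have "\<dots> \<le> K ^ (k\<^sup>2)" using K k by (intro power_increasing)
  finally have "root k Q ^ k \<le> (K ^ k) ^ k" using rQ by (simp add: power2_eq_square power_mult)
  then have "root k Q \<le> K ^ k" using power_le_imp_le_base[of "root k Q" "k - 1" "K ^ k"] k K by simp
  then have dK: "real d \<le> 2 * K ^ k" using d_up by linarith
  obtain \<X> where X: "rainbow_free R t \<X>"
    "real (fact t ^ R * d ^ k) \<le> 2 * (real k * (real d)\<^sup>2) * real ((n * d) ^ k) ^ n * real (card \<X>)"
    using exists_large_rainbow_free[OF t k(1) d1] Qd unfolding n_def Q_def c_def by blast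
  define N where "N = real (card \<X>)"
  have N: "N \<ge> 0" by (simp add: N_def)
  have nd: "real ((n * d) ^ k) \<le> (2 * real n) ^ k * c * rate n ^ R"
  proof -
    have "real ((n * d) ^ k) = real n ^ k * real d ^ k" by (simp add: power_mult_distrib)
    also have "\<dots> \<le> real n ^ k * (2 ^ k * Q)" using dQ by (intro mult_left_mono) auto
    finally show ?thesis by (simp add: Q_def power_mult_distrib mult_ac)
  qed
  \<comment> \<open>One of the \<open>n\<close> factors is kept exact so that its
    \<open>d ^ k\<close> cancels against the one on the left of the main inequality.\<close>
  have "real ((n * d) ^ k) ^ n = real ((n * d) ^ k) ^ (n - 1) * (real n ^ k * real d ^ k)"
    using n by (subst power_minus_mult[symmetric]) (simp_all add: power_mult_distrib)
  also have "\<dots> \<le> ((2 * real n) ^ k * c * rate n ^ R) ^ (n - 1) * (real n ^ k * real d ^ k)"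
    using nd by (intro mult_right_mono power_mono) auto
  also have "\<dots> = ((2 * real n) ^ k * c) ^ (n - 1) * (rate n ^ (n - 1)) ^ R * (real n ^ k * real d ^ k)"
    by (simp add: power_mult_distrib mult.commute flip: power_mult)
  also have "(rate n ^ (n - 1)) ^ R = fact n ^ R" using rate_power[OF n] by simp
  finally have Mn: "real ((n * d) ^ k) ^ n \<le>
    ((2 * real n) ^ k * c) ^ (n - 1) * fact n ^ R * (real n ^ k * real d ^ k)" .
  have const: "2 * (real k * (real d)\<^sup>2) * ((2 * real n) ^ k * c) ^ (n - 1) * real n ^ k \<le>
     (16 * K\<^sup>2 * real n * (2 * real n * c) ^ (n - 1)) ^ k"
  proof -
    have "(2::real) \<le> 2 ^ k" using k by (intro self_le_power) auto
    moreover have "real k \<le> 2 ^ k" by (rule less_imp_le[OF of_nat_less_two_power])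
    moreover have "(real d)\<^sup>2 \<le> (4 * K\<^sup>2) ^ k"
    proof -
      have "(real d)\<^sup>2 \<le> (2 * K ^ k)\<^sup>2" using dK by (intro power_mono) auto
      also have "\<dots> = 4 * (K\<^sup>2) ^ k" by (simp add: power_mult_distrib mult.commute flip: power_mult)
      also have "\<dots> \<le> 4 ^ k * (K\<^sup>2) ^ k" using k by (intro mult_right_mono self_le_power) auto
      finally show ?thesis by (simp add: power_mult_distrib)
    qed
    moreover have "((2 * real n) ^ k * c) ^ (n - 1) \<le> ((2 * real n) ^ k * c ^ k) ^ (n - 1)"
      using c k by (intro power_mono mult_left_mono self_le_power) auto
    ultimately have "2 * (real k * (real d)\<^sup>2) * ((2 * real n) ^ k * c) ^ (n - 1) * real n ^ k \<le>
      2 ^ k * (2 ^ k * (4 * K\<^sup>2) ^ k) * ((2 * real n) ^ k * c ^ k) ^ (n - 1) * real n ^ k"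
      using c by (intro mult_mono mult_nonneg_nonneg) auto
    also have "\<dots> = (2 * (2 * (4 * K\<^sup>2)) * (2 * real n * c) ^ (n - 1) * real n) ^ k"
      by (simp only: power_mult_distrib power_mult[symmetric] mult.commute[of k])
    finally show ?thesis by (simp add: mult_ac)
  qed
  have "(fact t :: real) ^ R * real d ^ k \<le> 2 * (real k * (real d)\<^sup>2) * real ((n * d) ^ k) ^ n * N"
    using X(2) by (simp add: N_def)
  also have "\<dots> \<le> 2 * (real k * (real d)\<^sup>2) *
      (((2 * real n) ^ k * c) ^ (n - 1) * fact n ^ R * (real n ^ k * real d ^ k)) * N"
    using Mn N by (intro mult_right_mono mult_left_mono) auto
  also have "\<dots> = (2 * (real k * (real d)\<^sup>2) * ((2 * real n) ^ k * c) ^ (n - 1) * real n ^ k) * (N * fact n ^ R * real d ^ k)"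
    by (simp add: mult_ac)
  also have "\<dots> \<le> (16 * K\<^sup>2 * real n * (2 * real n * c) ^ (n - 1)) ^ k * (N * fact n ^ R * real d ^ k)"
    using const N by (intro mult_right_mono) auto
  also have "(fact t :: real) ^ R = real t ^ R * fact n ^ R"
    unfolding tn fact_Suc by (simp only: power_mult_distrib of_nat_Suc of_nat_mult)
  finally have "real t ^ R * (fact n ^ R * real d ^ k) \<le>
      ((16 * K\<^sup>2 * real n * (2 * real n * c) ^ (n - 1)) ^ k * N) * (fact n ^ R * real d ^ k)"
    by (simp only: mult_ac)
  moreover have "(0::real) < fact n ^ R * real d ^ k" using d1 by simp
  ultimately have main: "real t ^ R \<le> (16 * K\<^sup>2 * real n * (2 * real n * c) ^ (n - 1)) ^ k * N"
    by (rule mult_right_le_imp_le)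
  \<comment> \<open>The label coordinate adds a factor \<open>t\<close>, absorbed by
    \<open>t ^ k\<close> since \<open>k \<ge> 1\<close>.\<close>
  have "real t ^ (R + 1) \<le> real t ^ k * real t ^ R"
    using t k by (simp add: self_le_power mult_right_mono)
  also have "\<dots> \<le> real t ^ k * ((16 * K\<^sup>2 * real n * (2 * real n * c) ^ (n - 1)) ^ k * N)"
    using main by (intro mult_left_mono) auto
  also have "\<dots> = (real t * (16 * K\<^sup>2 * real n * (2 * real n * c) ^ (n - 1))) ^ k * N"
    by (simp only: power_mult_distrib mult.assoc)
  also have "real t * (16 * K\<^sup>2 * real n * (2 * real n * c) ^ (n - 1)) = loss t"
    by (simp add: loss_def K_def c_def n_def numeral_2_eq_2)
  finally show ?thesis using that X(1) unfolding N_def by blast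
qed

lemma loss_ge_1:
  assumes "t \<ge> 2"
  shows "loss t \<ge> 1"
proof -
  have "1 \<le> real t ^ t" using assms by (intro one_le_power) simp
  then have tt: "1 \<le> 2 * real t ^ t" by linarith
  have n: "1 \<le> real (t - 1)" using assms by simp
  have "1 \<le> (2 * real t ^ t * rate (t - 1))\<^sup>2"
    using mult_mono[OF tt rate_ge_1[of "t - 1"]] by (intro one_le_power) auto
  moreover have "1 \<le> (2 * real (t - 1) * (2 * real t ^ t)) ^ (t - 2)"
    using mult_mono[of 1 "2 * real (t - 1)", OF _ tt] n by (intro one_le_power) auto
  ultimately have "1 * (1 * 1 * 1 * 1) \<le> loss t"
    unfolding loss_def using assms n by (intro mult_mono) auto
  then show ?thesis by simp
qed

theorem theorem4p3:
  fixes t :: nat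
  assumes "t \<ge> 2"
  shows "\<exists>D::real. D \<ge> 0 \<and>
    (\<forall>r::nat. r \<ge> 2 \<longrightarrow>
      (\<exists>(V :: nat set) (E :: nat set set) (N :: nat) (M :: nat \<Rightarrow> nat set set).
         hypergraph V E \<and> uniform r E \<and> partite r V E \<and> card V = t * r \<and>
         real N \<ge> real t powr (real r - D * sqrt (real r)) \<and>
         (\<forall>k\<in>{1..N}. matching E (M k) \<and> card (M k) = t) \<and>
         (\<forall>(j :: nat \<Rightarrow> nat) (e :: nat \<Rightarrow> nat set).
            (\<forall>i\<in>{1..t}. j i \<in> {1..N} \<and> e i \<in> M (j i)) \<and> disjoint_family_on e {1..t} \<longrightarrow>
            (\<forall>i\<in>{1..t}. \<forall>i'\<in>{1..t}. j i = j i'))))"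
proof (intro exI[of _ "2 * log t (loss t)"] conjI allI impI)
  have log0: "log t (loss t) \<ge> 0" using assms loss_ge_1[OF assms] by simp
  then show "2 * log t (loss t) \<ge> 0" by simp
  fix r :: nat
  assume r: "r \<ge> 2"
  define R where "R = r - 1"
  \<comment> \<open>The least \<open>k\<close> with \<open>R \<le> k\<^sup>2\<close>.\<close>
  define k where "k = nat \<lceil>sqrt R\<rceil>"
  have R: "R \<ge> 1" "R + 1 = r" using r by (auto simp: R_def)
  have k_low: "sqrt R \<le> real k" by (simp add: k_def)
  then have "R \<le> k\<^sup>2" using sqrt_le_D by (metis of_nat_le_iff of_nat_power)
  moreover have "k \<ge> 1" using \<open>R \<le> k\<^sup>2\<close> R by (cases k) auto
  ultimately obtain \<X> where X: "rainbow_free R t \<X>" "real t ^ (R + 1) \<le> loss t ^ k * real (card \<X>)"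
    using exists_rainbow_free_of_rate[OF assms R(1), of k] by blast
  \<comment> \<open>This explains the 2 in the witness \<open>D = 2 * log t (loss t)\<close>: from
    \<open>k \<le> sqrt R + 1 \<le> 2 * sqrt r\<close> it follows that
    \<open>loss t ^ k \<le> t powr (D * sqrt r)\<close>.\<close>
  have "1 \<le> sqrt r" using r by simp
  moreover have "sqrt R \<le> sqrt r" using R by simp
  moreover have "real k \<le> sqrt R + 1" unfolding k_def by simp
  ultimately have k_up: "real k \<le> 2 * sqrt r" by linarith
  have "real t powr (real r - 2 * log t (loss t) * sqrt r) \<le> real t powr (real r - log t (loss t) * real k)"
    using assms mult_left_mono[OF k_up log0] by (intro powr_mono) auto
  also have "\<dots> = real t ^ r / loss t ^ k"
    using assms loss_ge_1[OF assms] by (simp add: powr_diff powr_realpow powr_powr[symmetric] powr_log_cancel)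
  also have "\<dots> \<le> real (card \<X>)"
    using X(2)[unfolded R(2)] loss_ge_1[OF assms] by (simp add: pos_divide_le_eq mult.commute)
  finally have "real t powr (real r - 2 * log t (loss t) * sqrt r) \<le> real (card \<X>)" .
  then show "\<exists>(V :: nat set) (E :: nat set set) (N :: nat) (M :: nat \<Rightarrow> nat set set).
         hypergraph V E \<and> uniform r E \<and> partite r V E \<and> card V = t * r \<and>
         real N \<ge> real t powr (real r - 2 * log t (loss t) * sqrt (real r)) \<and>
         (\<forall>k\<in>{1..N}. matching E (M k) \<and> card (M k) = t) \<and>
         (\<forall>(j :: nat \<Rightarrow> nat) (e :: nat \<Rightarrow> nat set).
            (\<forall>i\<in>{1..t}. j i \<in> {1..N} \<and> e i \<in> M (j i)) \<and> disjoint_family_on e {1..t} \<longrightarrow>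
            (\<forall>i\<in>{1..t}. \<forall>i'\<in>{1..t}. j i = j i'))"
    using hypergraph_of_rainbow_free[OF assms X(1)] unfolding R(2) by blast
qed

end
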